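(* Let $G$ be an input graph on $V(G)$ which contains a subgraph $G_0$ (with $s,t\in V(G_0)$) such that: 1. $G_0$ contains a path from $s$ to $t$. 2. Every vertex in $V(G)\setminus V(G_0)$ is a lollipop of $G$. 3. Letting $k = |V(G_0)\setminus\{s,t\}|$, we have $k\geq 2$ and $n=|V(G)\setminus\{s,t\}|$ is divisible by $k$. Then for any integer $z$ with $1\le z\le k$ there is a family $\{\mathcal{V}_x\}$ such that: 1. Each $\mathcal{V}_x = \{V_{x1},\dots,V_{xk}\}$ is a partition of $V(G)\setminus\{s,t\}$ into $k$ sets of $\frac{n}{k}$ vertices each. 2. $|\{\mathcal{V}_x\}| \leq 2(4k)^z k\lg n$. 3. $m(G) \leq 2z\,2^z\, r(\{G_0\},z)\,|\{\mathcal{V}_x\}|\, n\lg n\,\bigl(2|\{\mathcal{V}_x\}| + 4 + zn\bigr)$.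
   Context: $\lg$ is the base-2 logarithm. $V(G)$ is a finite vertex set with distinguished distinct vertices $s,t$. An input graph is a directed graph (no loops) with vertex set $V(G)$. A vertex $v\in V(G)\setminus\{s,t\}$ is a lollipop of $G$ if $s\to v\in E(G)$ or $v\to t\in E(G)$. A monotone switching network for directed connectivity on $V(G)$ is a tuple $\langle G', s', t', \mu'\rangle$ where $G'$ is an undirected multigraph with distinguished vertices $s',t'$ and $\mu'$ assigns each edge of $G'$ a label of the form $v_1\to v_2$ with $v_1,v_2\in V(G)$, $v_1\ne v_2$. It accepts an input graph $G$ if there is a path in $G'$ from $s'$ to $t'$ all of whose edge labels are edges of $G$. It is sound if it accepts no input graph on $V(G)$ lacking a directed path from $s$ to $t$. Its size is $|V(G')\setminus\{s',t'\}|$. For a permutation $\sigma$ of $V(G)\setminus\{s,t\}$ (extended by fixing $s,t$), $\sigma(G)$ has edges $\{\sigma(v)\to\sigma(w): v\to w\in E(G)\}$. For $G$ containing a path from $s$ to $t$, $m(G)$ is the smallest size of a sound monotone switching network on $V(G)$ accepting $\sigma(G)$ for every such $\sigma$. Reversible pebble game on a directed graph $G$ with vertices $s,t$: start with a single pebble, on $s$; a move consists of choosing an edge $v\to w$ with a pebble on $v$ and adding or removing a pebble at $w$; the game is won when there is a pebble on $t$. A state is the set of pebbled vertices. For a set $I$ of graphs on a common vertex set, each containing a path from $s$ to $t$, $r(I,j)$ is the smallest size of a set $S$ of states, each having at most $j$ pebbles on vertices other than $s,t$, such that for every graph in $I$ the game on that graph can be won passing only through states in $S$ between the starting state and a winning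 state (the starting state and winning state need not be in $S$); $r(I,j)=\infty$ if no such $S$ exists. *)

theory Defs
  imports
    "HOL-Library.Extended_Real"
    "HOL-Library.Disjoint_Sets"
    "HOL-Combinatorics.Permutations"
begin

section \<open>Input graphs\<close>

text \<open>A graph on the vertex set \<open>V\<close> is represented by its edge relation.  There is a directed
  path from \<open>s\<close> to \<open>t\<close> iff \<open>(s, t) \<in> E\<^sup>*\<close>.\<close>

definition input_graph :: "'v set \<Rightarrow> ('v \<times> 'v) set \<Rightarrow> bool" where
  "input_graph V E \<longleftrightarrow> finite V \<and> E \<subseteq> V \<times> V \<and> irrefl E"

definition lollipop :: "'v set \<Rightarrow> 'v \<Rightarrow> 'v \<Rightarrow> ('v \<times> 'v) set \<Rightarrow> 'v \<Rightarrow> bool" where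
  "lollipop V s t E v \<longleftrightarrow> v \<in> V - {s, t} \<and> ((s, v) \<in> E \<or> (v, t) \<in> E)"

definition image_graph :: "('v \<Rightarrow> 'v) \<Rightarrow> ('v \<times> 'v) set \<Rightarrow> ('v \<times> 'v) set" where
  "image_graph \<sigma> E = {(\<sigma> v, \<sigma> w) | v w. (v, w) \<in> E}"

section \<open>Monotone switching networks\<close>

text \<open>The underlying undirected multigraph has abstract edges; \<open>sn_ends\<close> maps an edge to the set of
  its endpoints (a singleton for a loop).\<close>

record ('n, 'e, 'v) switching_network =
  sn_verts :: "'n set"
  sn_edges :: "'e set"
  sn_ends :: "'e \<Rightarrow> 'n set"
  sn_label :: "'e \<Rightarrow> 'v \<times> 'v"
  sn_source :: 'n
  sn_sink :: 'n

definition monotone_switching_network :: "'v set \<Rightarrow> ('n, 'e, 'v) switching_network \<Rightarrow> bool" where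
  "monotone_switching_network V N \<longleftrightarrow>
     finite (sn_verts N) \<and> finite (sn_edges N) \<and>
     sn_source N \<in> sn_verts N \<and> sn_sink N \<in> sn_verts N \<and>
     (\<forall>e\<in>sn_edges N. sn_ends N e \<subseteq> sn_verts N \<and> card (sn_ends N e) \<in> {1, 2}) \<and>
     (\<forall>e\<in>sn_edges N. fst (sn_label N e) \<in> V \<and> snd (sn_label N e) \<in> V \<and>
        fst (sn_label N e) \<noteq> snd (sn_label N e))"

definition sn_step :: "('n, 'e, 'v) switching_network \<Rightarrow> ('v \<times> 'v) set \<Rightarrow> ('n \<times> 'n) set" where
  "sn_step N E = {(a, b). \<exists>e\<in>sn_edges N. sn_ends N e = {a, b} \<and> sn_label N e \<in> E}"

definition sn_accepts :: "('n, 'e, 'v) switching_network \<Rightarrow> ('v \<times> 'v) set \<Rightarrow> bool" where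
  "sn_accepts N E \<longleftrightarrow> (sn_source N, sn_sink N) \<in> (sn_step N E)\<^sup>*"

definition sn_sound :: "'v set \<Rightarrow> 'v \<Rightarrow> 'v \<Rightarrow> ('n, 'e, 'v) switching_network \<Rightarrow> bool" where
  "sn_sound V s t N \<longleftrightarrow> (\<forall>E. input_graph V E \<and> (s, t) \<notin> E\<^sup>* \<longrightarrow> \<not> sn_accepts N E)"

definition sn_size :: "('n, 'e, 'v) switching_network \<Rightarrow> nat" where
  "sn_size N = card (sn_verts N - {sn_source N, sn_sink N})"

text \<open>Networks are finite, so up to isomorphism their vertices and edges are natural numbers.
  A permutation \<open>\<sigma> permutes A\<close> is the identity outside \<open>A\<close>, hence fixes \<open>s\<close> and \<open>t\<close> here.\<close>

definition m_size :: "'v set \<Rightarrow> 'v \<Rightarrow> 'v \<Rightarrow> ('v \<times> 'v) set \<Rightarrow> enat" where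
  "m_size V s t E =
     Inf {enat (sn_size N) | N :: (nat, nat, 'v) switching_network.
            monotone_switching_network V N \<and> sn_sound V s t N \<and>
            (\<forall>\<sigma>. \<sigma> permutes (V - {s, t}) \<longrightarrow> sn_accepts N (image_graph \<sigma> E))}"

section \<open>The reversible pebble game\<close>

text \<open>A state is the set of pebbled vertices.\<close>

definition pebble_move :: "('v \<times> 'v) set \<Rightarrow> 'v set \<Rightarrow> 'v set \<Rightarrow> bool" where
  "pebble_move E P P' \<longleftrightarrow>
     (\<exists>(v, w)\<in>E. v \<in> P \<and> (w \<notin> P \<and> P' = insert w P \<or> w \<in> P \<and> P' = P - {w}))"

text \<open>The states strictly between the first and the last one have to lie in \<open>S\<close>.\<close>

definition pebble_winnable ::
  "'v \<Rightarrow> 'v \<Rightarrow> ('v \<times> 'v) set \<Rightarrow> 'v set set \<Rightarrow> bool" where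
  "pebble_winnable s t E S \<longleftrightarrow>
     (\<exists>(l :: nat) P. P 0 = {s} \<and> t \<in> P l \<and>
        (\<forall>i<l. pebble_move E (P i) (P (Suc i))) \<and>
        (\<forall>i. 0 < i \<and> i < l \<longrightarrow> P i \<in> S))"

text \<open>For finite \<open>V\<close>; the infimum of the empty set is \<open>\<infinity>\<close>.\<close>

definition r_size ::
  "'v set \<Rightarrow> 'v \<Rightarrow> 'v \<Rightarrow> ('v \<times> 'v) set set \<Rightarrow> nat \<Rightarrow> enat" where
  "r_size V s t I j =
     Inf {enat (card S) | S. S \<subseteq> {P. P \<subseteq> V \<and> card (P - {s, t}) \<le> j} \<and>
            (\<forall>E\<in>I. pebble_winnable s t E S)}"

section \<open>Partitions\<close>

text \<open>The parts \<open>V\<^sub>1, \<dots>, V\<^sub>k\<close> are labelled by \<open>1, \<dots>, k\<close>: two partitions with the same parts in a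
  different order are different members of a family.\<close>

definition equipartition :: "'v set \<Rightarrow> nat \<Rightarrow> 'v set list \<Rightarrow> bool" where
  "equipartition A k Vs \<longleftrightarrow>
     length Vs = k \<and> distinct Vs \<and> partition_on A (set Vs) \<and>
     (\<forall>B\<in>set Vs. real (card B) = real (card A) / real k)"

end

theory Submission
  imports Defs Complex_Main "HOL-Library.FuncSet"
begin

text \<open>The vertices of the network are sets of cuts separating \<open>s\<close> from \<open>t\<close>: the source is the set of
  all cuts, the sink is the empty set, and an edge labelled \<open>v \<rightarrow> w\<close> may join two sets that differ only
  on cuts crossed by \<open>v \<rightarrow> w\<close>.  Such a network is sound, since a cut not crossed by the input
  graph stays in every set reached from the source.

  A pebble on the \<open>i\<close>-th vertex of \<open>G\<^sub>0\<close>, whose location is unknown, is represented by the parity of the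
  number of vertices of the part \<open>V\<^sub>i\<close> on the source side of the cut.  If \<open>V\<^sub>i\<close> contains the image of
  the \<open>i\<close>-th vertex and otherwise only lollipops, then toggling a lollipop costs one edge: out of
  \<open>s\<close>, flipping the expected parity, or into \<open>t\<close>, keeping it.  Hence a part can be moved
  element by element to a part of another partition, or shrunk to the pebbled vertex itself, after
  which an edge out of that vertex can be used.  A random equipartition fits \<open>z\<close> given pebbles with
  probability at least \<open>(4k)\<^sup>-\<^sup>z\<close>, so a greedy choice yields a small family fitting every placement.\<close>

section \<open>Networks whose vertices are sets of cuts\<close>

definition cuts :: "'v set \<Rightarrow> 'v \<Rightarrow> 'v \<Rightarrow> 'v set set" where
  "cuts V s t = {C. C \<subseteq> V \<and> s \<in> C \<and> t \<notin> C}"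

definition cut_link :: "'v set \<Rightarrow> 'v \<Rightarrow> 'v \<Rightarrow> ('v \<times> 'v) set \<Rightarrow> ('v set set \<times> 'v set set) set" where
  "cut_link V s t E =
     {(a, b). \<exists>(v, w)\<in>E. \<forall>C\<in>cuts V s t. (C \<in> a \<longleftrightarrow> C \<in> b) \<or> (v \<in> C \<and> w \<notin> C)}"

text \<open>All admissible labelled edges between the chosen vertices are put in. Soundness is then
  automatic: membership of an uncrossed cut is invariant along a path, and such a cut lies in the
  source but not in the sink. Only acceptance remains to be assumed.\<close>

lemma m_size_le_card:
  fixes V :: "'v set" and T :: "'v set set set"
  assumes E: "input_graph V E" and st: "s \<in> V" "t \<in> V" and T: "finite T"
    and Ver: "Ver = insert (cuts V s t) (insert {} T)"
    and acc: "\<And>\<sigma>. \<sigma> permutes (V - {s, t}) \<Longrightarrow>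
      (cuts V s t, {}) \<in> (cut_link V s t (image_graph \<sigma> E) \<inter> Ver \<times> Ver)\<^sup>*"
  shows "m_size V s t E \<le> enat (card T)"
proof -
  have finV: "finite V" and EV: "E \<subseteq> V \<times> V" and irr: "irrefl E"
    using E by (auto simp: input_graph_def)
  have finVer: "finite Ver" using T Ver by simp
  \<comment> \<open>Edges are quadruples, so that parallel edges with different labels stay
    distinct.\<close>
  define D where "D = {(a, b, v, w) | a b v w. a \<in> Ver \<and> b \<in> Ver \<and> v \<in> V \<and> w \<in> V \<and> v \<noteq> w \<and>
    (\<forall>C\<in>cuts V s t. (C \<in> a \<longleftrightarrow> C \<in> b) \<or> (v \<in> C \<and> w \<notin> C))}"
  have "D \<subseteq> Ver \<times> Ver \<times> V \<times> V" by (auto simp: D_def)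
  then have finD: "finite D" by (rule finite_subset) (use finVer finV in simp)
  \<comment> \<open>\<open>m_size\<close> ranges over networks on natural numbers, so vertices and
    edges are transported along injections.\<close>
  obtain h :: "'v set set \<Rightarrow> nat" where h: "inj_on h Ver"
    using finite_imp_inj_to_nat_seg[OF finVer] by blast
  obtain e :: "'v set set \<times> 'v set set \<times> 'v \<times> 'v \<Rightarrow> nat" where e: "inj_on e D"
    using finite_imp_inj_to_nat_seg[OF finD] by blast
  define N :: "(nat, nat, 'v) switching_network" where
    "N = \<lparr>sn_verts = h ` Ver, sn_edges = e ` D,
      sn_ends = (\<lambda>n. case inv_into D e n of (a, b, l) \<Rightarrow> {h a, h b}),
      sn_label = (\<lambda>n. case inv_into D e n of (a, b, l) \<Rightarrow> l),
      sn_source = h (cuts V s t), sn_sink = h {}\<rparr>"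
  have inv: "inv_into D e (e d) = d" if "d \<in> D" for d
    using that e by simp
  have card12: "card {p, q} \<in> {1, 2}" for p q :: nat
    by (cases "p = q") auto
  have ends: "sn_ends N (e (a, b, v, w)) = {h a, h b}"
    and lab: "sn_label N (e (a, b, v, w)) = (v, w)" if "(a, b, v, w) \<in> D" for a b v w
    using inv[OF that] by (auto simp: N_def)
  have edgesN: "sn_edges N = e ` D" by (simp add: N_def)
  have net: "monotone_switching_network V N"
    unfolding monotone_switching_network_def
  proof (intro conjI ballI)
    fix n assume "n \<in> sn_edges N"
    then obtain a b v w where d: "(a, b, v, w) \<in> D" and n: "n = e (a, b, v, w)"
      by (force simp: edgesN D_def)
    show "sn_ends N n \<subseteq> sn_verts N" "fst (sn_label N n) \<in> V" "snd (sn_label N n) \<in> V"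
      "fst (sn_label N n) \<noteq> snd (sn_label N n)"
      unfolding n ends[OF d] lab[OF d] using d by (auto simp: D_def N_def)
    show "card (sn_ends N n) \<in> {1, 2}" unfolding n ends[OF d] by (rule card12)
  qed (use finVer finD Ver in \<open>auto simp: N_def\<close>)
  have sound: "sn_sound V s t N"
    unfolding sn_sound_def
  proof (intro allI impI notI)
    fix H assume H: "input_graph V H \<and> (s, t) \<notin> H\<^sup>*" and "sn_accepts N H"
    \<comment> \<open>The set reachable from \<open>s\<close> is the cut that no edge of
      \<open>H\<close> crosses.\<close>
    define C where "C = {v \<in> V. (s, v) \<in> H\<^sup>*}"
    have C: "C \<in> cuts V s t" using H st by (auto simp: C_def cuts_def)
    have nocross: "\<not> (v \<in> C \<and> w \<notin> C)" if "(v, w) \<in> H" for v w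
      using that H by (auto simp: C_def input_graph_def intro: rtrancl_into_rtrancl)
    have "\<exists>a\<in>Ver. q = h a \<and> C \<in> a" if "(h (cuts V s t), q) \<in> (sn_step N H)\<^sup>*" for q
      using that
    proof induction
      case base
      then show ?case using C Ver by auto
    next
      case (step p q)
      then obtain c where c: "c \<in> Ver" "p = h c" "C \<in> c" by blast
      from step(2) obtain n where "n \<in> sn_edges N" and n: "sn_ends N n = {p, q}" "sn_label N n \<in> H"
        by (auto simp: sn_step_def)
      then obtain a b v w where d: "(a, b, v, w) \<in> D" and "n = e (a, b, v, w)"
        by (force simp: edgesN D_def)
      with n have pq: "{p, q} = {h a, h b}" and vw: "(v, w) \<in> H"
        using ends[OF d] lab[OF d] by auto
      have ab: "a \<in> Ver" "b \<in> Ver" "C \<in> a \<longleftrightarrow> C \<in> b"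
        using d nocross[OF vw] C by (auto simp: D_def)
      from pq consider "p = h a" "q = h b" | "p = h b" "q = h a"
        by (auto simp: doubleton_eq_iff)
      then show ?case
        using ab c h by cases (auto dest: inj_onD)
    qed
    from this[of "h {}"] \<open>sn_accepts N H\<close> obtain a where "a \<in> Ver" "h {} = h a" "C \<in> a"
      by (auto simp: sn_accepts_def N_def)
    moreover from this have "{} = a" using Ver by (intro inj_onD[OF h]) auto
    ultimately show False by blast
  qed
  have accepts: "sn_accepts N (image_graph \<sigma> E)" if \<sigma>: "\<sigma> permutes (V - {s, t})" for \<sigma>
  proof -
    have permV: "\<sigma> permutes V" using \<sigma> by (rule permutes_subset) auto
    have stepI: "(h a, h b) \<in> sn_step N (image_graph \<sigma> E)"
      if "(a, b) \<in> cut_link V s t (image_graph \<sigma> E) \<inter> Ver \<times> Ver" for a b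
    proof -
      from that obtain v w where vw: "(v, w) \<in> E"
        and c: "\<forall>C\<in>cuts V s t. (C \<in> a \<longleftrightarrow> C \<in> b) \<or> (\<sigma> v \<in> C \<and> \<sigma> w \<notin> C)"
        by (auto simp: cut_link_def image_graph_def)
      have "v \<noteq> w" using vw irr by (auto simp: irrefl_def)
      then have "(a, b, \<sigma> v, \<sigma> w) \<in> D"
        using that c vw EV permutes_inj[OF permV] permutes_in_image[OF permV]
        by (auto simp: D_def inj_eq)
      then show ?thesis
        using vw ends lab unfolding sn_step_def edgesN image_graph_def by fastforce
    qed
    have "(h (cuts V s t), h q) \<in> (sn_step N (image_graph \<sigma> E))\<^sup>*"
      if "(cuts V s t, q) \<in> (cut_link V s t (image_graph \<sigma> E) \<inter> Ver \<times> Ver)\<^sup>*" for q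
      using that by induction (blast intro: rtrancl_into_rtrancl stepI)+
    from this[OF acc[OF \<sigma>]] show ?thesis by (simp add: sn_accepts_def N_def)
  qed
  have "h ` Ver - {h (cuts V s t), h {}} \<subseteq> h ` T" using Ver by auto
  then have "sn_size N \<le> card (h ` T)"
    unfolding sn_size_def N_def using T by (auto intro: card_mono)
  also have "\<dots> \<le> card T" using T by (rule card_image_le)
  finally have "enat (sn_size N) \<le> enat (card T)" by simp
  moreover have "m_size V s t E \<le> enat (sn_size N)"
    unfolding m_size_def using net sound accepts by (intro Inf_lower) blast
  ultimately show ?thesis by (rule order_trans[rotated])
qed

section \<open>Parity states\<close>

definition parity_state ::
  "'v set \<Rightarrow> 'v \<Rightarrow> 'v \<Rightarrow> 'v set \<Rightarrow> ('v \<Rightarrow> 'v set) \<Rightarrow> 'v set \<Rightarrow> 'v set set" where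
  "parity_state V s t Q A b = {C \<in> cuts V s t. \<forall>i\<in>Q. odd (card (C \<inter> A i)) \<longleftrightarrow> i \<in> b}"

text \<open>In this and the next two assignments \<open>W\<close> is the set of vertices already
  processed. Here vertices in \<open>W\<close> already follow \<open>y\<close>, the others still
  follow \<open>x\<close>.\<close>

definition move_between ::
  "('v \<Rightarrow> 'v set) \<Rightarrow> ('v \<Rightarrow> 'v set) \<Rightarrow> 'v set \<Rightarrow> 'v \<Rightarrow> 'v set" where
  "move_between x y W = (\<lambda>i. (y i \<inter> W) \<union> (x i - W))"

text \<open>As \<open>W\<close> grows, the part holding \<open>v\<close> shrinks to
  \<open>{v}\<close>.\<close>

definition isolate :: "('v \<Rightarrow> 'v set) \<Rightarrow> 'v \<Rightarrow> 'v set \<Rightarrow> 'v \<Rightarrow> 'v set" where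
  "isolate x v W = (\<lambda>i. if v \<in> x i then insert v (x i - W) else x i)"

text \<open>The part holding \<open>v\<close> is already \<open>{v}\<close>, while the part of the
  new pebble \<open>w\<close> grows from empty to full.\<close>

definition extend_part ::
  "('v \<Rightarrow> 'v set) \<Rightarrow> 'v \<Rightarrow> 'v \<Rightarrow> 'v set \<Rightarrow> 'v \<Rightarrow> 'v set" where
  "extend_part x v w W = (\<lambda>i. if i = w then x i \<inter> W else if v \<in> x i then {v} else x i)"

text \<open>Processing the vertices in one fixed order keeps the number of stages linear instead of
  exponential.\<close>

definition prefixes :: "'v list \<Rightarrow> 'v set set" where
  "prefixes us = (\<lambda>j. set (take j us)) ` {..length us}"

definition selectors ::
  "'v set \<Rightarrow> ('v \<Rightarrow> 'v set) set \<Rightarrow> 'v set set \<Rightarrow> 'v set \<Rightarrow> ('v \<Rightarrow> 'v set) set" where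
  "selectors Q F WS X =
     (\<lambda>(x, y, W). move_between x y W) ` (F \<times> F \<times> WS) \<union>
     (\<lambda>(x, v, W). isolate x v W) ` (F \<times> X \<times> WS) \<union>
     (\<lambda>(x, v, w, W). extend_part x v w W) ` (F \<times> X \<times> Q \<times> WS)"

text \<open>The network is fixed before the placement is known, so every bit pattern
  \<open>b\<close> and every possible location of the isolated vertex is included.\<close>

definition parity_states ::
  "'v set \<Rightarrow> 'v \<Rightarrow> 'v \<Rightarrow> 'v list \<Rightarrow> ('v \<Rightarrow> 'v set) set \<Rightarrow> 'v set \<Rightarrow> 'v set set set" where
  "parity_states V s t us F Q =
     (\<lambda>(A, b). parity_state V s t Q A b) ` (selectors Q F (prefixes us) (insert s (set us)) \<times> Pow Q)"

lemma selectorsI: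
  assumes "x \<in> F" "W \<in> WS"
  shows "y \<in> F \<Longrightarrow> move_between x y W \<in> selectors Q F WS X"
    and "v \<in> X \<Longrightarrow> isolate x v W \<in> selectors Q F WS X"
    and "v \<in> X \<Longrightarrow> w \<in> Q \<Longrightarrow> extend_part x v w W \<in> selectors Q F WS X"
proof -
  show "move_between x y W \<in> selectors Q F WS X" if "y \<in> F"
    unfolding selectors_def using assms that
    by (intro UnI1 image_eqI[where x = "(x, y, W)"]) auto
  show "isolate x v W \<in> selectors Q F WS X" if "v \<in> X"
    unfolding selectors_def using assms that
    by (intro UnI1[OF UnI2] image_eqI[where x = "(x, v, W)"]) auto
  show "extend_part x v w W \<in> selectors Q F WS X" if "v \<in> X" "w \<in> Q"
    unfolding selectors_def using assms that
    by (intro UnI2 image_eqI[where x = "(x, v, w, W)"]) auto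
qed

lemma card_parity_states:
  assumes "finite F" "finite Q" "card Q \<le> z"
  shows "finite (parity_states V s t us F Q)"
    and "card (parity_states V s t us F Q) \<le>
      (card F * card F * Suc (length us) + card F * (Suc (length us))\<^sup>2 * Suc z) * 2 ^ z"
proof -
  let ?l = "Suc (length us)"
  let ?W = "prefixes us" and ?X = "insert s (set us)"
  have W: "finite ?W" "card ?W \<le> ?l"
    unfolding prefixes_def using card_image_le[of "{..length us}"] by auto
  have X: "finite ?X" "card ?X \<le> ?l"
    using card_length[of us] by (auto simp: card_insert_if)
  have sel: "finite (selectors Q F ?W ?X)"
    unfolding selectors_def using assms W X by auto
  have "card (selectors Q F ?W ?X) \<le>
      card (F \<times> F \<times> ?W) + card (F \<times> ?X \<times> ?W) + card (F \<times> ?X \<times> Q \<times> ?W)"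
    unfolding selectors_def using assms W X
    by (intro order_trans[OF card_Un_le] add_mono card_image_le) auto
  also have "\<dots> = card F * (card F * card ?W) + card F * (card ?X * card ?W) +
      card F * (card ?X * (card Q * card ?W))"
    by (simp only: card_cartesian_product)
  also have "\<dots> \<le> card F * (card F * ?l) + card F * (?l * ?l) + card F * (?l * (z * ?l))"
    using assms W X by (intro add_mono mult_le_mono order.refl)
  \<comment> \<open>In \<open>Suc z\<close> the 1 comes from \<open>isolate\<close>, the
    \<open>z\<close> from the choices of \<open>w\<close> in \<open>extend_part\<close>.\<close>
  also have "\<dots> = card F * card F * ?l + card F * ?l\<^sup>2 * Suc z"
    by (simp add: power2_eq_square algebra_simps)
  finally have c: "card (selectors Q F ?W ?X) \<le> card F * card F * ?l + card F * ?l\<^sup>2 * Suc z" .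
  show "finite (parity_states V s t us F Q)"
    unfolding parity_states_def using sel assms by auto
  have "card (parity_states V s t us F Q) \<le> card (selectors Q F ?W ?X \<times> Pow Q)"
    unfolding parity_states_def using sel assms by (intro card_image_le) auto
  also have "\<dots> \<le> (card F * card F * ?l + card F * ?l\<^sup>2 * Suc z) * 2 ^ z"
    unfolding card_cartesian_product card_Pow[OF assms(2)]
    using c assms by (intro mult_le_mono power_increasing) auto
  finally show "card (parity_states V s t us F Q) \<le>
      (card F * card F * ?l + card F * ?l\<^sup>2 * Suc z) * 2 ^ z" .
qed

text \<open>The part of each \<open>i\<close> in \<open>Q\<close> contains \<open>g i\<close> and no other vertex of \<open>g ` J\<close>; its remaining elements
  are then lollipops.\<close>

definition separates :: "'v set \<Rightarrow> ('v \<Rightarrow> 'v) \<Rightarrow> ('v \<Rightarrow> 'v set) \<Rightarrow> 'v set \<Rightarrow> bool" where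
  "separates J g x Q \<longleftrightarrow> (\<forall>i\<in>Q. \<forall>j\<in>J. g j \<in> x i \<longleftrightarrow> j = i)"

lemma separates_mono: "separates J g x Q \<Longrightarrow> Q' \<subseteq> Q \<Longrightarrow> separates J g x Q'"
  by (auto simp: separates_def)

text \<open>Adding \<open>u\<close> to a set flips the parity of its intersection with
  \<open>C\<close> exactly when \<open>u \<in> C\<close>. If \<open>C\<close> and \<open>B\<close>
  agree on \<open>u\<close>, both parities flip or neither does.\<close>

lemma odd_card_Int_cong:
  assumes "finite C" "finite B" "X - {u} = Y - {u}" "u \<in> C \<longleftrightarrow> u \<in> B"
  shows "(odd (card (C \<inter> X)) \<longleftrightarrow> odd (card (B \<inter> X))) \<longleftrightarrow>
    (odd (card (C \<inter> Y)) \<longleftrightarrow> odd (card (B \<inter> Y)))"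
proof -
  have *: "odd (card (D \<inter> X')) \<longleftrightarrow> odd (card (D \<inter> (X' - {u}))) \<noteq> (u \<in> D \<inter> X')"
    if "finite D" for D X'
  proof (cases "u \<in> D \<inter> X'")
    case True
    then have "D \<inter> X' = insert u (D \<inter> (X' - {u}))" by auto
    then have "card (D \<inter> X') = Suc (card (D \<inter> (X' - {u})))"
      using that by (metis DiffE IntE card_insert_disjoint finite_Int insertI1)
    then show ?thesis using True by simp
  next
    case False
    then have "D \<inter> X' = D \<inter> (X' - {u})" by auto
    with False show ?thesis by metis
  qed
  show ?thesis
    using *[of C X] *[of C Y] *[of B X] *[of B Y] assms by auto
qed

section \<open>Simulating the pebble game in the network for one placement\<close>

text \<open>\<open>E\<close> plays the permuted graph, \<open>g\<close> sends the inner vertices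
  \<open>J\<close> of the subgraph to their locations, \<open>F\<close> holds the partitions as
  functions on \<open>J\<close>, and \<open>QS\<close> the pebble sets of the allowed
  states.\<close>

locale lollipop_network =
  fixes V :: "'v set" and s t :: 'v and E :: "('v \<times> 'v) set" and us :: "'v list"
    and J :: "'v set" and g :: "'v \<Rightarrow> 'v" and F :: "('v \<Rightarrow> 'v set) set" and QS :: "'v set set"
  assumes finite_V: "finite V"
    and st: "s \<in> V" "t \<in> V" "s \<noteq> t"
    and us: "distinct us" "set us = V - {s, t}"
    and gJ: "g ` J \<subseteq> V - {s, t}"
    and lolli: "\<And>u. u \<in> V - {s, t} \<Longrightarrow> u \<notin> g ` J \<Longrightarrow> (s, u) \<in> E \<or> (u, t) \<in> E"
    and parts: "\<And>x i. x \<in> F \<Longrightarrow> i \<in> J \<Longrightarrow> x i \<subseteq> V - {s, t}"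
    and QS: "\<And>Q. Q \<in> QS \<Longrightarrow> Q \<subseteq> J"
begin

text \<open>The vertices expected on the source side of a cut when every vertex of \<open>g ` J\<close> is reachable; it
  fixes the parity bits.\<close>

definition B :: "'v set" where
  "B = g ` J \<union> {u \<in> V - {s, t}. (s, u) \<in> E}"

definition state :: "'v set \<Rightarrow> ('v \<Rightarrow> 'v set) \<Rightarrow> 'v set set" where
  "state Q A = {C \<in> cuts V s t. \<forall>i\<in>Q. odd (card (C \<inter> A i)) \<longleftrightarrow> odd (card (B \<inter> A i))}"

text \<open>Mentions neither \<open>E\<close> nor \<open>g\<close>, hence is the same for all
  placements.\<close>

definition Ver :: "'v set set set" where
  "Ver = insert (cuts V s t) (insert {} (\<Union>Q\<in>QS. parity_states V s t us F Q))"

abbreviation connected :: "'v set set \<Rightarrow> 'v set set \<Rightarrow> bool" where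
  "connected a b \<equiv> (a, b) \<in> (cut_link V s t E \<inter> Ver \<times> Ver)\<^sup>*"

lemma finite_B: "finite B"
  using finite_V gJ unfolding B_def by (auto intro: finite_subset)

lemma connected_sym: "connected a b \<Longrightarrow> connected b a"
proof -
  have "sym (cut_link V s t E \<inter> Ver \<times> Ver)"
    by (rule symI) (fastforce simp: cut_link_def)
  then show "connected a b \<Longrightarrow> connected b a"
    by (meson sym_rtrancl symD)
qed

lemma linkI:
  assumes "a \<in> Ver" "b \<in> Ver" "(v, w) \<in> E"
    and "\<And>C. C \<in> cuts V s t \<Longrightarrow> v \<notin> C \<or> w \<in> C \<Longrightarrow> C \<in> a \<longleftrightarrow> C \<in> b"
  shows "connected a b"
  using assms by (intro r_into_rtrancl) (fastforce simp: cut_link_def)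

lemma state_cong: "(\<And>i. i \<in> Q \<Longrightarrow> A i = A' i) \<Longrightarrow> state Q A = state Q A'"
  by (auto simp: state_def)

lemma state_empty: "state {} A = cuts V s t"
  by (auto simp: state_def)

lemma state_in_Ver:
  assumes "Q \<in> QS" "A \<in> selectors Q F (prefixes us) (insert s (set us))"
  shows "state Q A \<in> Ver"
proof -
  have "state Q A = parity_state V s t Q A {i \<in> Q. odd (card (B \<inter> A i))}"
    by (auto simp: state_def parity_state_def)
  then show ?thesis using assms by (auto simp: Ver_def parity_states_def)
qed

lemma connected_toggle:
  assumes ver: "state Q A \<in> Ver" "state Q A' \<in> Ver"
    and u: "u \<in> V - {s, t}" "\<And>i. i \<in> Q \<Longrightarrow> A i - {u} = A' i - {u}"
    and edge: "u \<in> g ` J \<Longrightarrow> state Q A = state Q A' \<or>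
      (\<exists>v. (v, u) \<in> E \<and> (\<forall>C\<in>state Q A \<union> state Q A'. v \<in> C))"
  shows "connected (state Q A) (state Q A')"
proof -
  have agree: "C \<in> state Q A \<longleftrightarrow> C \<in> state Q A'" if "C \<in> cuts V s t" "u \<in> C \<longleftrightarrow> u \<in> B" for C
  proof -
    have "finite C" using that finite_V by (auto simp: cuts_def intro: finite_subset)
    then have "(odd (card (C \<inter> A i)) \<longleftrightarrow> odd (card (B \<inter> A i))) \<longleftrightarrow>
        (odd (card (C \<inter> A' i)) \<longleftrightarrow> odd (card (B \<inter> A' i)))" if "i \<in> Q" for i
      using \<open>u \<in> C \<longleftrightarrow> u \<in> B\<close> that u finite_B by (intro odd_card_Int_cong)
    then show ?thesis using that by (auto simp: state_def)
  qed
  \<comment> \<open>A lollipop with both edges counts as one out of \<open>s\<close>, in accordance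
    with \<open>B\<close>.\<close>
  consider "u \<in> g ` J" | "u \<notin> g ` J" "(s, u) \<in> E" | "u \<notin> g ` J" "(s, u) \<notin> E" "(u, t) \<in> E"
    using lolli u(1) by blast
  then show ?thesis
  proof cases
    case 1
    from edge[OF 1] show ?thesis
    proof
      assume "\<exists>v. (v, u) \<in> E \<and> (\<forall>C\<in>state Q A \<union> state Q A'. v \<in> C)"
      then obtain v where v: "(v, u) \<in> E" "\<forall>C\<in>state Q A \<union> state Q A'. v \<in> C" by blast
      have "u \<in> B" using 1 by (simp add: B_def)
      \<comment> \<open>Cuts omitting \<open>v\<close> lie in neither state; cuts containing
        \<open>u\<close> agree with \<open>B\<close> on it.\<close>
      then show ?thesis using v agree by (intro linkI[OF ver v(1)]) blast
    qed simp
  next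
    case 2
    then have "u \<in> B" using u by (simp add: B_def)
    then show ?thesis using agree by (intro linkI[OF ver 2(2)]) (auto simp: cuts_def)
  next
    case 3
    then have "u \<notin> B" by (simp add: B_def)
    then show ?thesis using agree by (intro linkI[OF ver 3(3)]) (auto simp: cuts_def)
  qed
qed

text \<open>Toggles the vertices of \<open>us\<close> one after another; distinctness ensures that
  each is new when its turn comes.\<close>

lemma connected_chain:
  assumes ver: "\<And>W. W \<in> prefixes us \<Longrightarrow> state Q (A W) \<in> Ver"
    and u: "\<And>W i u. i \<in> Q \<Longrightarrow> u \<in> V - {s, t} \<Longrightarrow> u \<notin> W \<Longrightarrow> A W i - {u} = A (insert u W) i - {u}"
    and edge: "\<And>W u. u \<in> g ` J \<Longrightarrow> u \<notin> W \<Longrightarrow> state Q (A W) = state Q (A (insert u W)) \<or>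
      (\<exists>v. (v, u) \<in> E \<and> (\<forall>C\<in>state Q (A W) \<union> state Q (A (insert u W)). v \<in> C))"
  shows "connected (state Q (A {})) (state Q (A (V - {s, t})))"
proof -
  have "connected (state Q (A {})) (state Q (A (set (take j us))))" if "j \<le> length us" for j
    using that
  proof (induction j)
    case (Suc j)
    let ?W = "set (take j us)" and ?u = "us ! j"
    have W: "set (take (Suc j) us) = insert ?u ?W"
      using Suc.prems by (simp add: take_Suc_conv_app_nth)
    have new: "?u \<notin> ?W"
      using Suc.prems us(1) by (auto simp: in_set_conv_nth nth_eq_iff_index_eq)
    have "?W \<in> prefixes us" "insert ?u ?W \<in> prefixes us"
      using Suc.prems unfolding prefixes_def W[symmetric] by auto
    then have ver': "state Q (A ?W) \<in> Ver" "state Q (A (insert ?u ?W)) \<in> Ver"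
      by (simp_all add: ver)
    have "?u \<in> V - {s, t}" using Suc.prems us(2) by (metis Suc_le_eq nth_mem)
    then have "connected (state Q (A ?W)) (state Q (A (insert ?u ?W)))"
      using connected_toggle[OF ver' _ u edge] new by blast
    then show ?case using Suc unfolding W by simp
  qed simp
  from this[of "length us"] show ?thesis using us(2) by simp
qed

lemma full_prefix: "V - {s, t} \<in> prefixes us"
  unfolding prefixes_def us(2)[symmetric] by force

lemma connected_change_partition:
  assumes "Q \<in> QS" "x \<in> F" "y \<in> F" "separates J g x Q" "separates J g y Q"
  shows "connected (state Q x) (state Q y)"
proof -
  have QJ: "Q \<subseteq> J" using assms(1) by (rule QS)
  have "connected (state Q (move_between x y {})) (state Q (move_between x y (V - {s, t})))"
  proof (rule connected_chain)
    fix W assume "W \<in> prefixes us"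
    then show "state Q (move_between x y W) \<in> Ver"
      using assms by (intro state_in_Ver selectorsI) auto
  next
    fix W u assume "u \<in> g ` J" "u \<notin> W"
    then have "state Q (move_between x y W) = state Q (move_between x y (insert u W))"
      using assms(4,5) by (intro state_cong) (fastforce simp: move_between_def separates_def)
    then show "state Q (move_between x y W) = state Q (move_between x y (insert u W)) \<or>
      (\<exists>v. (v, u) \<in> E \<and> (\<forall>C\<in>state Q (move_between x y W) \<union>
        state Q (move_between x y (insert u W)). v \<in> C))" ..
  qed (use parts[of x] parts[of y] assms QJ in \<open>fastforce simp: move_between_def\<close>)+
  moreover have "state Q (move_between x y (V - {s, t})) = state Q y"
    using parts[of x] parts[of y] assms QJ by (intro state_cong) (fastforce simp: move_between_def)
  ultimately show ?thesis by (simp add: move_between_def)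
qed

lemma connected_isolate:
  assumes "Q \<in> QS" "x \<in> F" "separates J g x Q" "p \<in> Q"
  shows "connected (state Q x) (state Q (isolate x (g p) (V - {s, t})))"
proof -
  have QJ: "Q \<subseteq> J" using assms(1) by (rule QS)
  have "connected (state Q (isolate x (g p) {})) (state Q (isolate x (g p) (V - {s, t})))"
  proof (rule connected_chain)
    fix W assume "W \<in> prefixes us"
    moreover have "g p \<in> set us" using us(2) gJ assms QJ by blast
    ultimately show "state Q (isolate x (g p) W) \<in> Ver"
      using assms by (intro state_in_Ver selectorsI) auto
  next
    fix W u assume "u \<in> g ` J" "u \<notin> W"
    then have "state Q (isolate x (g p) W) = state Q (isolate x (g p) (insert u W))"
      using assms(3,4) QJ by (intro state_cong) (fastforce simp: isolate_def separates_def)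
    then show "state Q (isolate x (g p) W) = state Q (isolate x (g p) (insert u W)) \<or>
      (\<exists>v. (v, u) \<in> E \<and> (\<forall>C\<in>state Q (isolate x (g p) W) \<union>
        state Q (isolate x (g p) (insert u W)). v \<in> C))" ..
  qed (use parts[of x] assms QJ in \<open>fastforce simp: isolate_def\<close>)+
  moreover have "isolate x (g p) {} = x" by (simp add: isolate_def fun_eq_iff insert_absorb)
  ultimately show ?thesis by simp
qed

text \<open>Once its part is \<open>{v}\<close>, the parity bit forces \<open>v\<close> into every
  cut of the state; for \<open>v = s\<close> this holds anyway. Hence \<open>g w\<close> can enter
  the part of \<open>w\<close> along \<open>v \<rightarrow> g w\<close>, and the rest of that part
  consists of lollipops.\<close>

lemma connected_extend:
  assumes "Q \<in> QS" "x \<in> F" "separates J g x Q" "w \<in> Q"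
    and v: "(v, g w) \<in> E" "v = s \<or> v \<in> g ` (Q - {w})"
  shows "connected (state (Q - {w}) (isolate x v (V - {s, t}))) (state Q (isolate x v (V - {s, t})))"
proof -
  let ?U = "V - {s, t}"
  have QJ: "Q \<subseteq> J" using assms(1) by (rule QS)
  have "w \<in> J" using QJ assms(4) by blast
  \<comment> \<open>Either \<open>v = s\<close>, which lies in no part, or \<open>v\<close> is the
    location of a pebble other than \<open>w\<close>.\<close>
  then have xw: "v \<notin> x w"
    using v(2) parts[of x w] assms QJ st by (auto simp: separates_def)
  have iso: "isolate x v ?U i = (if v \<in> x i then {v} else x i)" if "i \<in> Q" for i
    using that parts[of x i] assms(2) QJ by (auto simp: isolate_def)
  have vC: "v \<in> C" if C: "C \<in> state Q (extend_part x v w W)" for C W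
  proof -
    from v(2) show ?thesis
    proof
      assume "v \<in> g ` (Q - {w})"
      then obtain p where p: "p \<in> Q" "p \<noteq> w" "v = g p" by blast
      then have "v \<in> x p" using assms(3) QJ by (auto simp: separates_def)
      then have "extend_part x v w W p = {v}" using p by (simp add: extend_part_def)
      moreover have "v \<in> B" using p QJ by (auto simp: B_def)
      moreover have "odd (card (C \<inter> extend_part x v w W p)) \<longleftrightarrow>
          odd (card (B \<inter> extend_part x v w W p))"
        using C p(1) by (simp add: state_def)
      ultimately show "v \<in> C" by (cases "v \<in> C") auto
    qed (use C in \<open>simp add: state_def cuts_def\<close>)
  qed
  have "connected (state Q (extend_part x v w {})) (state Q (extend_part x v w ?U))"
  proof (rule connected_chain)
    fix W assume "W \<in> prefixes us"
    moreover have "v \<in> insert s (set us)" using v us(2) gJ assms QJ by auto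
    ultimately show "state Q (extend_part x v w W) \<in> Ver"
      using assms by (intro state_in_Ver selectorsI) auto
  next
    fix W u assume u: "u \<in> g ` J" "u \<notin> W"
    show "state Q (extend_part x v w W) = state Q (extend_part x v w (insert u W)) \<or>
      (\<exists>v'. (v', u) \<in> E \<and> (\<forall>C\<in>state Q (extend_part x v w W) \<union>
        state Q (extend_part x v w (insert u W)). v' \<in> C))"
    proof (cases "u = g w")
      case True
      then show ?thesis using v(1) vC by blast
    next
      case False
      then have "u \<notin> x w" using u(1) assms(3,4) by (auto simp: separates_def)
      then have "state Q (extend_part x v w W) = state Q (extend_part x v w (insert u W))"
        by (intro state_cong) (auto simp: extend_part_def)
      then show ?thesis ..
    qed
  next
    fix W i u assume "i \<in> Q" "u \<in> V - {s, t}" "u \<notin> W"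
    then show "extend_part x v w W i - {u} = extend_part x v w (insert u W) i - {u}"
      by (auto simp: extend_part_def)
  qed
  \<comment> \<open>An empty part gives an even count on both sides, so its constraint is
    void.\<close>
  moreover have "state Q (extend_part x v w {}) = state (Q - {w}) (isolate x v ?U)"
    using iso by (auto simp: state_def extend_part_def)
  moreover have "state Q (extend_part x v w ?U) = state Q (isolate x v ?U)"
    using iso xw parts[of x w] assms(2) QJ \<open>w \<in> Q\<close>
    by (intro state_cong) (auto simp: extend_part_def)
  ultimately show ?thesis by simp
qed

text \<open>Isolate \<open>v\<close>, grow the part of \<open>w\<close> from nothing, then undo the
  isolation. By symmetry the same path read backwards removes the pebble.\<close>

lemma connected_add_pebble:
  assumes "Q \<in> QS" "Q - {w} = {} \<or> Q - {w} \<in> QS" "x \<in> F" "separates J g x Q" "w \<in> Q"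
    and v: "(v, g w) \<in> E" "v = s \<or> v \<in> g ` (Q - {w})"
  shows "connected (state (Q - {w}) x) (state Q x)"
proof -
  let ?U = "V - {s, t}"
  have QJ: "Q \<subseteq> J" using assms(1) by (rule QS)
  have iso: "connected (state Q' x) (state Q' (isolate x v ?U))"
    if Q': "Q' \<subseteq> Q" "Q' \<in> QS \<or> Q' = {}" "v = s \<or> v \<in> g ` Q'" for Q'
    using Q'(3)
  proof
    assume "v = s"
    \<comment> \<open>No part contains \<open>s\<close>, so isolating it changes nothing.\<close>
    then have "isolate x v ?U i = x i" if "i \<in> Q'" for i
      using that parts[of x i] assms(3) QJ Q' by (auto simp: isolate_def)
    then show ?thesis by (simp cong: state_cong)
  next
    assume "v \<in> g ` Q'"
    then show ?thesis
      using Q' assms(3) separates_mono[OF assms(4) Q'(1)] connected_isolate by blast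
  qed
  have "connected (state (Q - {w}) x) (state (Q - {w}) (isolate x v ?U))"
    using assms by (intro iso) auto
  also have "connected (state (Q - {w}) (isolate x v ?U)) (state Q (isolate x v ?U))"
    using assms by (intro connected_extend)
  also have "connected (state Q (isolate x v ?U)) (state Q x)"
    using assms by (intro connected_sym[OF iso]) auto
  finally show ?thesis .
qed

text \<open>After isolation every cut of the state contains \<open>g p\<close>, hence is crossed by
  \<open>g p \<rightarrow> t\<close>; the state is linked to the empty set.\<close>

lemma connected_win:
  assumes "Q \<in> QS" "x \<in> F" "separates J g x Q" "p \<in> Q" "(g p, t) \<in> E"
  shows "connected (state Q x) {}"
proof -
  let ?A = "isolate x (g p) (V - {s, t})"
  have QJ: "Q \<subseteq> J" using assms(1) by (rule QS)
  have "connected (state Q x) (state Q ?A)"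
    using assms by (intro connected_isolate)
  also have "connected (state Q ?A) {}"
  proof (rule linkI)
    show "state Q ?A \<in> Ver"
      using assms us(2) gJ QJ full_prefix by (intro state_in_Ver selectorsI) auto
    fix C assume C: "C \<in> cuts V s t" "g p \<notin> C \<or> t \<in> C"
    have "g p \<in> x p" using assms QJ by (auto simp: separates_def)
    then have "?A p = {g p}" using parts[of x p] assms QJ by (auto simp: isolate_def)
    moreover have "g p \<in> B" using assms QJ by (auto simp: B_def)
    moreover have "g p \<notin> C" using C by (simp add: cuts_def)
    ultimately have "odd (card (C \<inter> ?A p)) \<noteq> odd (card (B \<inter> ?A p))" by simp
    then show "C \<in> state Q ?A \<longleftrightarrow> C \<in> {}"
      using assms(4) unfolding state_def by blast
  qed (use assms in \<open>auto simp: Ver_def\<close>)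
  finally show ?thesis .
qed

text \<open>Follows the winning play. A pebble is added under a partition separating the larger set;
  it is removed by reversing such an addition, after which any partition separating the smaller set
  can be reached.\<close>

lemma connected_game:
  assumes g: "g s = s" "g t = t"
    and E0: "\<And>v w. (v, w) \<in> E0 \<Longrightarrow> (g v, g w) \<in> E"
    and S: "\<And>P. P \<in> S \<Longrightarrow> P - {s, t} \<in> QS"
    and sep: "\<And>Q. Q \<in> QS \<Longrightarrow> \<exists>x\<in>F. separates J g x Q"
    and win: "pebble_winnable s t E0 S"
    and irr: "irrefl E0"
  shows "connected (cuts V s t) {}"
proof -
  obtain l0 P where P0: "P 0 = {s}" and tl0: "t \<in> P l0"
    and move0: "\<And>i. i < l0 \<Longrightarrow> pebble_move E0 (P i) (P (Suc i))"
    and S0: "\<And>i. 0 < i \<Longrightarrow> i < l0 \<Longrightarrow> P i \<in> S"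
    using win by (auto simp: pebble_winnable_def)
  \<comment> \<open>Stopping when \<open>t\<close> is first pebbled ensures that every earlier move
    starts from \<open>s\<close> or from a pebble in \<open>Q i\<close>.\<close>
  define l where "l = (LEAST i. t \<in> P i)"
  have tl: "t \<in> P l" unfolding l_def using tl0 by (rule LeastI)
  have l: "l \<le> l0" unfolding l_def using tl0 by (rule Least_le)
  have notl: "t \<notin> P i" if "i < l" for i using not_less_Least[of i] that l_def by blast
  define Q where "Q i = P i - {s, t}" for i
  have Q0: "Q 0 = {}" by (simp add: Q_def P0)
  have QS_Q: "Q i \<in> QS \<or> Q i = {}" if "i < l" for i
    using S[OF S0, of i] that l Q0 by (cases "i = 0") (auto simp: Q_def)
  have QJ: "Q i \<subseteq> J" if "i < l" for i using QS_Q[OF that] QS by auto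
  have source: "v = s \<or> v \<in> Q i" if "v \<in> P i" "i < l" for v i
    using notl[OF that(2)] that(1) by (auto simp: Q_def)
  \<comment> \<open>The invariant covers all separating \<open>x\<close>, because the next addition
    may need a partition other than the current one.\<close>
  have reach: "\<forall>x\<in>F. separates J g x (Q i) \<longrightarrow> connected (cuts V s t) (state (Q i) x)" if "i < l" for i
    using that
  proof (induction i)
    case 0
    then show ?case by (simp add: Q0 state_empty)
  next
    case (Suc i)
    then have i: "i < l" by simp
    note IH = Suc.IH[OF i]
    obtain v w where vw: "(v, w) \<in> E0" "v \<in> P i"
      and or: "w \<notin> P i \<and> P (Suc i) = insert w (P i) \<or> w \<in> P i \<and> P (Suc i) = P i - {w}"
      using move0[of i] i l by (auto simp: pebble_move_def)
    have "w \<noteq> t" using or notl[OF i] notl[OF Suc.prems] by auto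
    have "v \<noteq> w" using vw irr by (auto simp: irrefl_def)
    \<comment> \<open>Moves at \<open>s\<close> do not change \<open>Q\<close>.\<close>
    consider (same) "Q (Suc i) = Q i"
      | (add) "w \<in> Q (Suc i)" "Q i = Q (Suc i) - {w}" "w \<noteq> s"
      | (remove) "w \<in> Q i" "Q (Suc i) = Q i - {w}" "w \<noteq> s"
      using or \<open>w \<noteq> t\<close> by (cases "w = s") (auto simp: Q_def)
    then show ?case
    proof cases
      case same
      then show ?thesis using IH by simp
    next
      case add
      then have "Q (Suc i) \<in> QS" using QS_Q[OF Suc.prems] by auto
      moreover have "g v = s \<or> g v \<in> g ` Q i" using source[OF vw(2) i] g by auto
      ultimately have conn: "connected (state (Q i) x) (state (Q (Suc i)) x)"
        if "x \<in> F" "separates J g x (Q (Suc i))" for x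
        using that add E0[OF vw(1)] QS_Q[OF i] unfolding add(2) by (intro connected_add_pebble) auto
      show ?thesis
      proof (intro ballI impI)
        fix x assume x: "x \<in> F" "separates J g x (Q (Suc i))"
        have "separates J g x (Q i)" unfolding add(2) by (rule separates_mono[OF x(2)]) auto
        then have "connected (cuts V s t) (state (Q i) x)" using IH x(1) by blast
        then show "connected (cuts V s t) (state (Q (Suc i)) x)"
          using conn[OF x] by (rule rtrancl_trans)
      qed
    next
      case remove
      then have Qi: "Q i \<in> QS" using QS_Q[OF i] by auto
      obtain y where y: "y \<in> F" "separates J g y (Q i)" using sep[OF Qi] by blast
      then have y': "separates J g y (Q (Suc i))"
        using remove by (intro separates_mono[OF y(2)]) auto
      \<comment> \<open>Since \<open>v \<noteq> w\<close>, the pebble on \<open>v\<close> survives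
        the removal and supports the reversed addition.\<close>
      have "g v = s \<or> g v \<in> g ` Q (Suc i)"
        using source[OF vw(2) i] g \<open>v \<noteq> w\<close> remove(2) by auto
      then have "connected (state (Q (Suc i)) y) (state (Q i) y)"
        using y Qi remove E0[OF vw(1)] QS_Q[OF Suc.prems] unfolding remove(2)
        by (intro connected_add_pebble) auto
      then have conn_rev: "connected (state (Q i) y) (state (Q (Suc i)) y)"
        by (rule connected_sym)
      have "connected (cuts V s t) (state (Q i) y)" using IH y by blast
      then have conn: "connected (cuts V s t) (state (Q (Suc i)) y)"
        using conn_rev by (rule rtrancl_trans)
      show ?thesis
      proof (intro ballI impI)
        fix x assume x: "x \<in> F" "separates J g x (Q (Suc i))"
        show "connected (cuts V s t) (state (Q (Suc i)) x)"
        proof (cases "Q (Suc i) = {}")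
          case True
          then show ?thesis by (simp add: state_empty)
        next
          case False
          then have "connected (state (Q (Suc i)) y) (state (Q (Suc i)) x)"
            using QS_Q[OF Suc.prems] x y(1) y' by (intro connected_change_partition) auto
          with conn show ?thesis by (rule rtrancl_trans)
        qed
      qed
    qed
  qed
  have "l \<noteq> 0" using tl P0 st by (metis singletonD)
  then obtain i where i: "l = Suc i" by (cases l) auto
  obtain v w where vw: "(v, w) \<in> E0" "v \<in> P i"
    and or: "w \<notin> P i \<and> P (Suc i) = insert w (P i) \<or> w \<in> P i \<and> P (Suc i) = P i - {w}"
    using move0[of i] i l by (auto simp: pebble_move_def)
  have w: "w = t" using or tl notl[of i] i by auto
  then have edge: "(g v, t) \<in> E" using E0[OF vw(1)] g by simp
  have "v = s \<or> v \<in> Q i" using source[OF vw(2)] i by simp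
  then show ?thesis
  proof
    assume "v = s"
    then have "(s, t) \<in> E" using edge g by simp
    \<comment> \<open>Every cut is crossed by \<open>s \<rightarrow> t\<close>, so one edge joins
      source and sink.\<close>
    then show ?thesis by (intro linkI) (auto simp: Ver_def cuts_def)
  next
    assume v: "v \<in> Q i"
    then have Qi: "Q i \<in> QS" using QS_Q[of i] i by auto
    obtain y where y: "y \<in> F" "separates J g y (Q i)" using sep[OF Qi] by blast
    have "connected (cuts V s t) (state (Q i) y)" using reach[of i] i y by simp
    also have "connected (state (Q i) y) {}" using connected_win[OF Qi y v edge] .
    finally show ?thesis .
  qed
qed

end

section \<open>Counting injections\<close>

lemma card_inj_PiE_insert:
  assumes "finite I" "a \<notin> I" "\<And>i. i \<in> insert a I \<Longrightarrow> finite (L i)"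
  shows "card {f \<in> PiE (insert a I) L. inj_on f (insert a I)} =
    (\<Sum>f\<in>{f \<in> PiE I L. inj_on f I}. card (L a - f ` I))"
proof -
  let ?N = "{f \<in> PiE I L. inj_on f I}"
  let ?D = "SIGMA f:?N. L a - f ` I"
  have "{f \<in> PiE (insert a I) L. inj_on f (insert a I)} = (\<lambda>(f, y). f(a := y)) ` ?D"
  proof (intro equalityI subsetI)
    fix f assume f: "f \<in> {f \<in> PiE (insert a I) L. inj_on f (insert a I)}"
    then have "(f(a := undefined), f a) \<in> ?D"
      using assms(2) by (auto simp: PiE_def Pi_def extensional_def inj_on_def)
    moreover have "f = (\<lambda>(f, y). f(a := y)) (f(a := undefined), f a)" by simp
    ultimately show "f \<in> (\<lambda>(f, y). f(a := y)) ` ?D" by blast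
  next
    fix f assume "f \<in> (\<lambda>(f, y). f(a := y)) ` ?D"
    then obtain f' y where f': "f' \<in> ?N" "y \<in> L a - f' ` I" and f: "f = f'(a := y)" by auto
    then show "f \<in> {f \<in> PiE (insert a I) L. inj_on f (insert a I)}"
      using assms(2) by (auto simp: f PiE_def Pi_def extensional_def inj_on_def)
  qed
  moreover have "inj_on (\<lambda>(f, y). f(a := y)) ?D"
  proof (rule inj_onI, clarify)
    fix f y f' y' assume *: "f \<in> PiE I L" "f' \<in> PiE I L" "f(a := y) = f'(a := y')"
    have "f = (f(a := y))(a := undefined)" using *(1) assms(2) by (auto simp: PiE_def extensional_def)
    moreover have "f' = (f'(a := y'))(a := undefined)"
      using *(2) assms(2) by (auto simp: PiE_def extensional_def)
    ultimately show "f = f' \<and> y = y'" using *(3) by (metis fun_upd_same)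
  qed
  moreover have "finite ?N"
    by (rule finite_subset[of _ "PiE I L"]) (use assms in \<open>auto intro: finite_PiE\<close>)
  ultimately show ?thesis using assms(3) by (simp add: card_image)
qed

lemma card_inj_PiE_const:
  assumes "finite I" "finite B"
  shows "card {f \<in> I \<rightarrow>\<^sub>E B. inj_on f I} = (\<Prod>l<card I. card B - l)"
  using assms(1)
proof (induction I rule: finite_induct)
  case (insert a I)
  have "card (B - f ` I) = card B - card I" if "f \<in> I \<rightarrow>\<^sub>E B" "inj_on f I" for f
    using that insert.hyps(1) by (subst card_Diff_subset) (auto simp: card_image)
  then show ?case
    using insert assms by (subst card_inj_PiE_insert) (auto simp: prod.lessThan_Suc)
qed simp

text \<open>The sets for \<open>Z\<close> are disjoint from each other and from the rest, so each
  index in \<open>Z\<close> keeps all its \<open>m\<close> choices.\<close>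

lemma card_inj_PiE_Un_ge:
  assumes "finite I" "finite Z" "I \<inter> Z = {}" "\<And>i. i \<in> I \<union> Z \<Longrightarrow> finite (L i)"
    and "\<And>i. i \<in> Z \<Longrightarrow> card (L i) = m"
    and "\<And>i j. i \<in> Z \<Longrightarrow> j \<in> I \<union> Z \<Longrightarrow> i \<noteq> j \<Longrightarrow> L i \<inter> L j = {}"
  shows "m ^ card Z * card {f \<in> PiE I L. inj_on f I} \<le> card {f \<in> PiE (I \<union> Z) L. inj_on f (I \<union> Z)}"
  using assms(2-)
proof (induction Z rule: finite_induct)
  case (insert a Z)
  have "card (L a - f ` (I \<union> Z)) = m" if "f \<in> PiE (I \<union> Z) L" for f
  proof -
    have "f i \<notin> L a" if i: "i \<in> I \<union> Z" for i
    proof -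
      have "L a \<inter> L i = {}" using i insert.hyps insert.prems(1) by (intro insert.prems(4)) auto
      then show ?thesis using i \<open>f \<in> PiE (I \<union> Z) L\<close> by auto
    qed
    then have "L a - f ` (I \<union> Z) = L a" by auto
    then show ?thesis using insert.prems(3) by simp
  qed
  moreover have "a \<notin> I \<union> Z" using insert.hyps insert.prems(1) by auto
  ultimately have "card {f \<in> PiE (insert a (I \<union> Z)) L. inj_on f (insert a (I \<union> Z))} =
      m * card {f \<in> PiE (I \<union> Z) L. inj_on f (I \<union> Z)}"
    using insert.hyps insert.prems(2) assms(1) by (subst card_inj_PiE_insert) auto
  moreover have "m ^ card Z * card {f \<in> PiE I L. inj_on f I} \<le>
      card {f \<in> PiE (I \<union> Z) L. inj_on f (I \<union> Z)}"
    using insert.prems by (intro insert.IH) auto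
  ultimately show ?case using insert.hyps by simp
qed simp

text \<open>Compares all injections of \<open>k\<close> indices into \<open>k\<close> parts of size
  \<open>m\<close> with those fixing the parts of \<open>z\<close> indices. The first
  \<open>z\<close> factors are at most \<open>k * m\<close> each; the others lose at most
  \<open>exp z\<close> in total, which is below \<open>4 ^ z\<close>.\<close>

lemma falling_product_bound:
  fixes k z m :: nat
  assumes "z \<le> k" "0 < m"
  shows "(\<Prod>l<k. k * m - l) \<le> (4 * k) ^ z * (m ^ z * (\<Prod>l<k - z. (k - z) * m - l))"
proof -
  define d where "d = k - z"
  have k: "k = z + d" using assms by (simp add: d_def)
  have split: "(\<Prod>l<k. k * m - l) = (\<Prod>l<z. k * m - l) * (\<Prod>l<d. k * m - (z + l))"
  proof -
    have "(\<Prod>l<z + d. h l) = (\<Prod>l<z. h l) * (\<Prod>l<d. h (z + l))" for h :: "nat \<Rightarrow> nat"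
      by (induction d) (auto simp: mult.assoc)
    then show ?thesis unfolding k .
  qed
  have first: "(\<Prod>l<z. k * m - l) \<le> (k * m) ^ z"
    using prod_mono[of "{..<z}" "\<lambda>l. k * m - l" "\<lambda>_. k * m"] by simp
  \<comment> \<open>Factorwise: the gap between \<open>k * m - (z + l)\<close> and
    \<open>d * m - l\<close> is \<open>z * (m - 1)\<close>, while \<open>d * m - l\<close> is at
    least \<open>d * (m - 1)\<close>.\<close>
  have "real (\<Prod>l<d. k * m - (z + l)) \<le> (\<Prod>l<d. (1 + real z / real d) * real (d * m - l))"
    unfolding of_nat_prod
  proof (intro prod_mono conjI)
    fix l assume "l \<in> {..<d}"
    then have l: "l < d" by simp
    obtain m' where m: "m = Suc m'" using assms(2) by (cases m) auto
    have dl: "d * m - l = d * m' + (d - l)" and kl: "k * m - (z + l) = d * m' + (d - l) + z * m'"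
      using l by (auto simp: m k algebra_simps)
    have "real z * (real d * real m') \<le> real z * (real d * real m' + real (d - l))"
      by (intro mult_left_mono) auto
    then have "real (z * m') \<le> real z / real d * real (d * m - l)"
      using l unfolding dl by (simp add: field_simps)
    then show "real (k * m - (z + l)) \<le> (1 + real z / real d) * real (d * m - l)"
      unfolding kl dl by (simp add: algebra_simps)
  qed simp
  also have "\<dots> = (1 + real z / real d) ^ d * real (\<Prod>l<d. d * m - l)"
    by (simp add: prod.distrib)
  also have "\<dots> \<le> 4 ^ z * real (\<Prod>l<d. d * m - l)"
  proof (rule mult_right_mono)
    \<comment> \<open>By \<open>1 + x \<le> exp x\<close>; for \<open>z = k\<close> the exponent
      \<open>d\<close> is 0 and the power is 1.\<close>
    have "(1 + real z / real d) ^ d \<le> exp (real z)"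
    proof (cases "d = 0")
      case False
      have "(1 + real z / real d) ^ d \<le> exp (real z / real d) ^ d"
        by (intro power_mono exp_ge_add_one_self) auto
      also have "\<dots> = exp (real z)" using False by (simp flip: exp_of_nat_mult)
      finally show ?thesis .
    qed simp
    also have "\<dots> = exp 1 ^ z" by (simp flip: exp_of_nat_mult)
    also have "\<dots> \<le> 4 ^ z" using exp_le by (intro power_mono) auto
    finally show "(1 + real z / real d) ^ d \<le> 4 ^ z" .
  qed (auto simp: prod_nonneg)
  finally have "real (\<Prod>l<d. k * m - (z + l)) \<le> real (4 ^ z * (\<Prod>l<d. d * m - l))" by simp
  then have "(\<Prod>l<d. k * m - (z + l)) \<le> 4 ^ z * (\<Prod>l<d. d * m - l)"
    by (simp only: of_nat_le_iff)
  with first have "(\<Prod>l<k. k * m - l) \<le> (k * m) ^ z * (4 ^ z * (\<Prod>l<d. d * m - l))"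
    unfolding split by (rule mult_le_mono)
  then show ?thesis by (simp add: d_def power_mult_distrib mult_ac)
qed

section \<open>Greedy covering and random placements\<close>

text \<open>Greedy choice: by averaging, some member of \<open>\<Omega>\<close> is good for a
  fraction \<open>p\<close> of the elements still uncovered, so each choice leaves at most a
  fraction \<open>1 - p\<close> of them.\<close>

lemma ex_small_cover:
  fixes p :: real
  assumes fin: "finite \<Omega>" "finite R" "\<Omega> \<noteq> {}"
    and p: "p \<le> 1"
    and many: "\<And>r. r \<in> R \<Longrightarrow> p * real (card \<Omega>) \<le> real (card {\<omega> \<in> \<Omega>. good \<omega> r})"
  shows "\<exists>F\<subseteq>\<Omega>. card F \<le> T \<and> real (card {r \<in> R. \<forall>\<omega>\<in>F. \<not> good \<omega> r}) \<le> (1 - p) ^ T * real (card R)"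
proof (induction T)
  case 0
  then show ?case by (intro exI[of _ "{}"]) auto
next
  case (Suc T)
  then obtain F where F: "F \<subseteq> \<Omega>" "card F \<le> T"
    and le: "real (card {r \<in> R. \<forall>\<omega>\<in>F. \<not> good \<omega> r}) \<le> (1 - p) ^ T * real (card R)" by blast
  define X where "X = {r \<in> R. \<forall>\<omega>\<in>F. \<not> good \<omega> r}"
  have finX: "finite X" using fin by (simp add: X_def)
  have "\<exists>\<omega>\<in>\<Omega>. p * real (card X) \<le> real (card {r \<in> X. good \<omega> r})"
  proof (rule ccontr)
    assume "\<not> ?thesis"
    then have "(\<Sum>\<omega>\<in>\<Omega>. real (card {r \<in> X. good \<omega> r})) < (\<Sum>\<omega>\<in>\<Omega>. p * real (card X))"
      using fin by (intro sum_strict_mono) auto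
    \<comment> \<open>Counting the good pairs by rows and by columns contradicts the assumption that
      every \<open>\<omega>\<close> falls short.\<close>
    moreover have "(\<Sum>\<omega>\<in>\<Omega>. real (card {r \<in> X. good \<omega> r})) = (\<Sum>r\<in>X. real (card {\<omega> \<in> \<Omega>. good \<omega> r}))"
      using sum_multicount_gen[OF fin(1) finX, of good "\<lambda>r. card {\<omega> \<in> \<Omega>. good \<omega> r}"]
      by (simp flip: of_nat_sum)
    moreover have "(\<Sum>r\<in>X. p * real (card \<Omega>)) \<le> (\<Sum>r\<in>X. real (card {\<omega> \<in> \<Omega>. good \<omega> r}))"
      using many by (intro sum_mono) (auto simp: X_def)
    ultimately show False by (simp add: mult_ac)
  qed
  then obtain \<omega> where \<omega>: "\<omega> \<in> \<Omega>" "p * real (card X) \<le> real (card {r \<in> X. good \<omega> r})" by blast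
  have eq: "{r \<in> R. \<forall>\<omega>'\<in>insert \<omega> F. \<not> good \<omega>' r} = X - {r \<in> X. good \<omega> r}"
    by (auto simp: X_def)
  have "real (card (X - {r \<in> X. good \<omega> r})) = real (card X) - real (card {r \<in> X. good \<omega> r})"
    using finX by (subst card_Diff_subset) (auto simp: of_nat_diff card_mono)
  also have "\<dots> \<le> (1 - p) * real (card X)" using \<omega>(2) by (simp add: algebra_simps)
  also have "\<dots> \<le> (1 - p) * ((1 - p) ^ T * real (card R))"
    using le p by (intro mult_left_mono) (auto simp: X_def)
  finally have "real (card {r \<in> R. \<forall>\<omega>'\<in>insert \<omega> F. \<not> good \<omega>' r}) \<le> (1 - p) ^ Suc T * real (card R)"
    unfolding eq by simp
  moreover have "card (insert \<omega> F) \<le> Suc T"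
    using F finite_subset[OF F(1) fin(1)] by (simp add: card_insert_if)
  ultimately show ?case using F \<omega>(1) by (intro exI[of _ "insert \<omega> F"]) auto
qed

text \<open>For a fixed partition, a random placement is separated with probability at least
  \<open>1 / (4 * k) ^ z\<close>.\<close>

lemma card_separating_injections:
  fixes x :: "'v \<Rightarrow> 'v set"
  assumes J: "finite J" "card J = k" and Z: "Z \<subseteq> J" "card Z = z"
    and disj: "\<And>i j. i \<in> J \<Longrightarrow> j \<in> J \<Longrightarrow> i \<noteq> j \<Longrightarrow> x i \<inter> x j = {}"
    and card_x: "\<And>i. i \<in> J \<Longrightarrow> card (x i) = m" and m: "0 < m"
    and U: "(\<Union>i\<in>J. x i) = U"
  shows "card {f \<in> J \<rightarrow>\<^sub>E U. inj_on f J} \<le>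
    (4 * k) ^ z * card {f \<in> J \<rightarrow>\<^sub>E U. inj_on f J \<and> separates J f x Z}"
proof -
  have fin_x: "finite (x i)" if "i \<in> J" for i
    using card_x[OF that] m by (intro card_ge_0_finite) simp
  have finZ: "finite Z" using J Z finite_subset by blast
  have zk: "z \<le> k" using J Z card_mono by blast
  have card_UN: "card (\<Union>i\<in>I. x i) = card I * m" if "I \<subseteq> J" for I
  proof -
    have "card (\<Union>i\<in>I. x i) = (\<Sum>i\<in>I. card (x i))"
      using that disj fin_x J
      by (intro card_UN_disjoint ballI impI) (meson finite_subset subsetD)+
    also have "\<dots> = (\<Sum>i\<in>I. m)" using that card_x by (intro sum.cong) auto
    finally show ?thesis by simp
  qed
  define I where "I = J - Z"
  have J_eq: "J = I \<union> Z" and IZ: "I \<inter> Z = {}" "finite I" "card I = k - z"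
    using J Z finZ by (auto simp: I_def card_Diff_subset)
  \<comment> \<open>Indices in \<open>Z\<close> go to their own parts, the others to the union of
    the parts outside \<open>Z\<close>; such placements are separated.\<close>
  define L where "L j = (if j \<in> Z then x j else (\<Union>i\<in>I. x i))" for j
  have finL: "finite (L i)" if "i \<in> J" for i
    using that fin_x IZ J_eq by (auto simp: L_def)
  have prod: "m ^ card Z * card {f \<in> PiE I L. inj_on f I} \<le>
      card {f \<in> PiE (I \<union> Z) L. inj_on f (I \<union> Z)}"
  proof (rule card_inj_PiE_Un_ge)
    fix i j assume "i \<in> Z" "j \<in> I \<union> Z" "i \<noteq> j"
    then show "L i \<inter> L j = {}"
      using disj[of i] J_eq IZ by (auto simp: L_def)
  qed (use IZ finZ finL J_eq Z card_x in \<open>auto simp: L_def\<close>)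
  have cardI: "card {f \<in> PiE I L. inj_on f I} = (\<Prod>l<k - z. (k - z) * m - l)"
  proof -
    have "PiE I L = (I \<rightarrow>\<^sub>E (\<Union>i\<in>I. x i))"
      using IZ by (intro PiE_cong) (auto simp: L_def)
    moreover have "finite (\<Union>i\<in>I. x i)" using fin_x IZ J_eq by auto
    ultimately show ?thesis
      using IZ card_UN[of I] J_eq by (simp add: card_inj_PiE_const)
  qed
  have sub: "{f \<in> PiE J L. inj_on f J} \<subseteq> {f \<in> J \<rightarrow>\<^sub>E U. inj_on f J \<and> separates J f x Z}"
  proof (rule subsetI)
    fix f assume "f \<in> {f \<in> PiE J L. inj_on f J}"
    then have f: "f \<in> PiE J L" and inj: "inj_on f J" by auto
    have Lf: "f j \<in> L j" if "j \<in> J" for j using f that by auto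
    have LU: "L j \<subseteq> U" if "j \<in> J" for j
      using that J_eq U by (auto simp: L_def)
    have "f \<in> J \<rightarrow>\<^sub>E U" using f LU by (auto simp: PiE_def)
    moreover
    have "f j \<in> x i \<longleftrightarrow> j = i" if ij: "i \<in> Z" "j \<in> J" for i j
    proof
      assume "f j \<in> x i"
      moreover have "x i' \<inter> x i = {}" if "i' \<in> J" "i' \<noteq> i" for i'
        using disj that ij(1) Z by blast
      moreover have "\<exists>i'\<in>J. f j \<in> x i' \<and> (i' = j \<or> i' \<notin> Z)"
        using Lf[OF ij(2)] ij J_eq IZ by (cases "j \<in> Z") (auto simp: L_def)
      ultimately show "j = i" using ij by blast
    next
      assume "j = i"
      then show "f j \<in> x i" using Lf[OF ij(2)] ij(1) by (simp add: L_def)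
    qed
    then have "separates J f x Z" by (auto simp: separates_def)
    ultimately show "f \<in> {f \<in> J \<rightarrow>\<^sub>E U. inj_on f J \<and> separates J f x Z}"
      using inj by simp
  qed
  have "finite (J \<rightarrow>\<^sub>E U)"
    using J fin_x U by (auto intro!: finite_PiE)
  then have "finite {f \<in> J \<rightarrow>\<^sub>E U. inj_on f J \<and> separates J f x Z}" by simp
  from card_mono[OF this sub] have low: "m ^ z * (\<Prod>l<k - z. (k - z) * m - l) \<le>
      card {f \<in> J \<rightarrow>\<^sub>E U. inj_on f J \<and> separates J f x Z}"
    using prod unfolding cardI Z(2) J_eq[symmetric] by (rule order_trans[rotated])
  have "card {f \<in> J \<rightarrow>\<^sub>E U. inj_on f J} = (\<Prod>l<k. k * m - l)"
    using card_UN[of J] J U fin_x by (subst card_inj_PiE_const) auto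
  also have "\<dots> \<le> (4 * k) ^ z * (m ^ z * (\<Prod>l<k - z. (k - z) * m - l))"
    using zk m by (rule falling_product_bound)
  finally show ?thesis using low by (meson mult_le_mono2 order_trans)
qed

section \<open>Separating families of equipartitions\<close>

text \<open>\<open>idx\<close> numbers the vertices of \<open>J\<close> by list positions, which
  turns a list of parts into an assignment usable by the network.\<close>

definition part :: "('v \<Rightarrow> nat) \<Rightarrow> 'v set list \<Rightarrow> 'v \<Rightarrow> 'v set" where
  "part idx Vs i = Vs ! idx i"

lemma equipartition_part:
  assumes V: "equipartition U k Vs" and U: "card U = k * m" "0 < k" and idx: "bij_betw idx J {..<k}"
  shows "i \<in> J \<Longrightarrow> j \<in> J \<Longrightarrow> i \<noteq> j \<Longrightarrow> part idx Vs i \<inter> part idx Vs j = {}"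
    and "i \<in> J \<Longrightarrow> card (part idx Vs i) = m"
    and "(\<Union>i\<in>J. part idx Vs i) = U"
proof -
  have V': "length Vs = k" "distinct Vs" "partition_on U (set Vs)"
    "\<And>B. B \<in> set Vs \<Longrightarrow> real (card B) = real (card U) / real k"
    using V by (auto simp: equipartition_def)
  have idx': "idx i < k" if "i \<in> J" for i using idx that by (auto simp: bij_betw_def)
  have mem: "part idx Vs i \<in> set Vs" if "i \<in> J" for i
    using idx'[OF that] V' by (simp add: part_def)
  show "part idx Vs i \<inter> part idx Vs j = {}" if "i \<in> J" "j \<in> J" "i \<noteq> j"
  proof -
    have "idx i \<noteq> idx j" using idx that by (auto simp: bij_betw_def inj_on_def)
    then have "part idx Vs i \<noteq> part idx Vs j"
      using V' idx' that by (simp add: part_def nth_eq_iff_index_eq)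
    then show ?thesis
      using partition_onD2[OF V'(3)] mem that by (auto simp: disjoint_def)
  qed
  show "card (part idx Vs i) = m" if "i \<in> J"
  proof -
    have "real (card (part idx Vs i)) = real m" using V'(4)[OF mem[OF that]] U by simp
    then show ?thesis by simp
  qed
  have "part idx Vs ` J = (!) Vs ` (idx ` J)" by (auto simp: part_def)
  also have "\<dots> = set Vs" using idx V'(1) by (auto simp: bij_betw_def in_set_conv_nth)
  finally show "(\<Union>i\<in>J. part idx Vs i) = U" using partition_onD1[OF V'(3)] by simp
qed

lemma finite_equipartitions: "finite U \<Longrightarrow> finite {Vs. equipartition U k Vs}"
proof -
  assume "finite U"
  have "{Vs. equipartition U k Vs} \<subseteq> {Vs. set Vs \<subseteq> Pow U \<and> length Vs = k}"
    by (auto simp: equipartition_def partition_on_def)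
  moreover have "finite {Vs. set Vs \<subseteq> Pow U \<and> length Vs = k}"
    using \<open>finite U\<close> by (intro finite_lists_length_eq) simp
  ultimately show ?thesis by (rule finite_subset)
qed

lemma ex_equipartition:
  assumes "finite U" "card U = k * m" "0 < k" "0 < m"
  shows "\<exists>Vs. equipartition U k Vs"
proof -
  have "card ({..<k} \<times> {..<m}) = card U" using assms by (simp add: card_cartesian_product)
  then obtain e where e: "bij_betw e ({..<k} \<times> {..<m}) U"
    using finite_same_card_bij[of "{..<k} \<times> {..<m}" U] assms by auto
  then have inj: "inj_on e ({..<k} \<times> {..<m})" and im: "e ` ({..<k} \<times> {..<m}) = U"
    by (auto simp: bij_betw_def)
  \<comment> \<open>The rows of a \<open>k\<close> by \<open>m\<close> grid filled with
    \<open>U\<close>.\<close>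
  define P where "P i = e ` ({i} \<times> {..<m})" for i
  have P_disj: "P i \<inter> P j = {}" if "i < k" "j < k" "i \<noteq> j" for i j
    using inj that unfolding P_def inj_on_def by blast
  have P_ne: "P i \<noteq> {}" for i using assms by (auto simp: P_def)
  have "inj_on P {..<k}"
    by (rule inj_onI) (use P_disj P_ne in fastforce)
  moreover have "card (P i) = m" if "i < k" for i
    unfolding P_def using that
    by (subst card_image) (auto intro: inj_on_subset[OF inj] simp: card_cartesian_product)
  moreover have "partition_on U (P ` {..<k})"
  proof (rule partition_onI)
    show "\<Union>(P ` {..<k}) = U" unfolding im[symmetric] P_def by blast
    show "disjnt p q" if "p \<in> P ` {..<k}" "q \<in> P ` {..<k}" "p \<noteq> q" for p q
      using that P_disj by (fastforce simp: disjnt_def)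
    show "{} \<notin> P ` {..<k}" using P_ne by auto
  qed
  ultimately have "equipartition U k (map P [0..<k])"
    using assms by (auto simp: equipartition_def distinct_map atLeast0LessThan)
  then show ?thesis ..
qed

text \<open>The complements of the two images have equal size, so the partial matching extends to
  all of \<open>U\<close>.\<close>

lemma ex_permutes_extending:
  assumes "finite U" "f \<in> J \<rightarrow> U" "f' \<in> J \<rightarrow> U" "inj_on f J" "inj_on f' J"
  shows "\<exists>\<tau>. \<tau> permutes U \<and> (\<forall>j\<in>J. \<tau> (f j) = f' j)"
proof -
  have sub: "f ` J \<subseteq> U" "f' ` J \<subseteq> U" using assms by auto
  have b1: "bij_betw (f' \<circ> inv_into J f) (f ` J) (f' ` J)"
    using assms by (intro bij_betw_trans[of _ _ J] bij_betw_inv_into) (auto simp: bij_betw_def)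
  have "card (U - f ` J) = card (U - f' ` J)"
    using card_Diff_subset[of "f ` J" U] card_Diff_subset[of "f' ` J" U] finite_subset[OF _ assms(1)]
      card_image[OF assms(4)] card_image[OF assms(5)] sub by simp
  then obtain b where b2: "bij_betw b (U - f ` J) (U - f' ` J)"
    using finite_same_card_bij[of "U - f ` J" "U - f' ` J"] assms(1) by auto
  define \<tau> where "\<tau> u = (if u \<in> f ` J then f' (inv_into J f u) else if u \<in> U then b u else u)" for u
  have "bij_betw \<tau> (f ` J \<union> (U - f ` J)) (f' ` J \<union> (U - f' ` J))"
  proof (rule bij_betw_combine)
    show "bij_betw \<tau> (f ` J) (f' ` J)"
      by (rule bij_betw_cong[THEN iffD1, OF _ b1]) (simp add: \<tau>_def)
    show "bij_betw \<tau> (U - f ` J) (U - f' ` J)"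
      by (rule bij_betw_cong[THEN iffD1, OF _ b2]) (simp add: \<tau>_def)
  qed blast
  then have "bij_betw \<tau> U U" using sub by (simp add: Un_absorb1)
  then have "\<tau> permutes U"
    by (rule bij_imp_permutes) (use sub in \<open>auto simp: \<tau>_def\<close>)
  moreover have "\<forall>j\<in>J. \<tau> (f j) = f' j" using assms by (simp add: \<tau>_def)
  ultimately show ?thesis by blast
qed

text \<open>By symmetry the number of separating partitions does not depend on the placement, so
  below it can be averaged over all placements.\<close>

lemma card_separating_partitions_le:
  fixes idx :: "'v \<Rightarrow> nat"
  assumes U: "finite U" and idx: "bij_betw idx J {..<k}" and Z: "Z \<subseteq> J"
    and f: "f \<in> J \<rightarrow> U" "f' \<in> J \<rightarrow> U" "inj_on f J" "inj_on f' J"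
  shows "card {Vs \<in> {Vs. equipartition U k Vs}. separates J f (part idx Vs) Z} \<le>
    card {Vs \<in> {Vs. equipartition U k Vs}. separates J f' (part idx Vs) Z}"
proof -
  obtain \<tau> where \<tau>: "\<tau> permutes U" and \<tau>f: "\<And>j. j \<in> J \<Longrightarrow> \<tau> (f j) = f' j"
    using ex_permutes_extending[OF U f] by blast
  have inj: "inj \<tau>" using \<tau> by (rule permutes_inj)
  have inj2: "inj ((`) \<tau>)" by (rule injI) (simp add: inj_image_eq_iff[OF inj])
  \<comment> \<open>Moving every part by \<open>\<tau>\<close> injects the partitions separating
    \<open>f\<close> into those separating \<open>f'\<close>.\<close>
  let ?h = "map ((`) \<tau>)"
  show ?thesis
  proof (rule card_inj_on_le)
    show "inj_on ?h {Vs \<in> {Vs. equipartition U k Vs}. separates J f (part idx Vs) Z}"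
      using inj2 by (auto intro!: inj_onI dest: map_injective)
    show "finite {Vs \<in> {Vs. equipartition U k Vs}. separates J f' (part idx Vs) Z}"
      using finite_equipartitions[OF U] by simp
    show "?h ` {Vs \<in> {Vs. equipartition U k Vs}. separates J f (part idx Vs) Z} \<subseteq>
        {Vs \<in> {Vs. equipartition U k Vs}. separates J f' (part idx Vs) Z}"
    proof (rule image_subsetI)
      fix Vs assume "Vs \<in> {Vs \<in> {Vs. equipartition U k Vs}. separates J f (part idx Vs) Z}"
      then have V: "equipartition U k Vs" and sep: "separates J f (part idx Vs) Z" by auto
      have idx': "idx i < length Vs" if "i \<in> J" for i
        using idx that V by (auto simp: bij_betw_def equipartition_def)
      have "{} \<notin> set Vs" using V by (auto simp: equipartition_def partition_on_def)
      then have "(`) \<tau> ` set Vs - {{}} = (`) \<tau> ` set Vs" by auto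
      then have "partition_on U ((`) \<tau> ` set Vs)"
        using partition_on_inj_image[of U "set Vs" \<tau>] V inj permutes_image[OF \<tau>]
        by (auto simp: equipartition_def inj_on_def)
      moreover have "distinct (?h Vs)"
        using V inj2 by (auto simp: equipartition_def distinct_map intro: inj_on_subset)
      moreover have "card (\<tau> ` B) = card B" for B
        using inj by (intro card_image) (auto intro: inj_on_subset)
      ultimately have "equipartition U k (?h Vs)"
        using V by (simp add: equipartition_def)
      moreover have "separates J f' (part idx (?h Vs)) Z"
        using sep Z idx' inj_image_mem_iff[OF inj]
        by (auto simp: separates_def part_def subset_iff simp flip: \<tau>f)
      ultimately show "?h Vs \<in> {Vs \<in> {Vs. equipartition U k Vs}. separates J f' (part idx Vs) Z}"
        by simp
    qed
  qed
qed

text \<open>Double counting of pairs of a partition and a placement bounds the average over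
  placements; by symmetry the bound holds for the given \<open>f\<close>.\<close>

lemma separating_partitions_fraction:
  fixes idx :: "'v \<Rightarrow> nat"
  assumes U: "finite U" "card U = k * m" "0 < k" "0 < m"
    and J: "finite J" and idx: "bij_betw idx J {..<k}" and Z: "Z \<subseteq> J" "card Z = z"
    and f: "f \<in> J \<rightarrow>\<^sub>E U" "inj_on f J"
  shows "card {Vs. equipartition U k Vs} \<le>
    (4 * k) ^ z * card {Vs \<in> {Vs. equipartition U k Vs}. separates J f (part idx Vs) Z}"
proof -
  let ?O = "{Vs. equipartition U k Vs}" and ?I = "{f \<in> J \<rightarrow>\<^sub>E U. inj_on f J}"
  let ?a = "\<lambda>f. card {Vs \<in> ?O. separates J f (part idx Vs) Z}"
  have cardJ: "card J = k" using bij_betw_same_card[OF idx] by simp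
  have finO: "finite ?O" using U by (intro finite_equipartitions)
  have finI: "finite ?I" using J U by (auto intro!: finite_subset[OF _ finite_PiE[of J "\<lambda>_. U"]])
  have "card ?O * card ?I = (\<Sum>Vs\<in>?O. card ?I)" by simp
  also have "\<dots> \<le> (\<Sum>Vs\<in>?O. (4 * k) ^ z * card {f \<in> ?I. separates J f (part idx Vs) Z})"
  proof (rule sum_mono)
    fix Vs assume "Vs \<in> ?O"
    then have V: "equipartition U k Vs" by simp
    have "{f \<in> ?I. separates J f (part idx Vs) Z} =
        {f \<in> J \<rightarrow>\<^sub>E U. inj_on f J \<and> separates J f (part idx Vs) Z}" by auto
    then show "card ?I \<le> (4 * k) ^ z * card {f \<in> ?I. separates J f (part idx Vs) Z}"
      using card_separating_injections[OF J cardJ Z equipartition_part(1,2)[OF V U(2,3) idx]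
        U(4) equipartition_part(3)[OF V U(2,3) idx]] by simp
  qed
  also have "\<dots> = (4 * k) ^ z * (\<Sum>Vs\<in>?O. card {f \<in> ?I. separates J f (part idx Vs) Z})"
    by (simp add: sum_distrib_left)
  also have "(\<Sum>Vs\<in>?O. card {f \<in> ?I. separates J f (part idx Vs) Z}) = (\<Sum>f'\<in>?I. ?a f')"
    using finO finI by (intro sum_multicount_gen) auto
  also have "\<dots> \<le> (\<Sum>f'\<in>?I. ?a f)"
    using U(1) idx Z f by (intro sum_mono card_separating_partitions_le) (auto simp: PiE_def)
  finally have "card ?I * card ?O \<le> card ?I * ((4 * k) ^ z * ?a f)" by (simp add: mult_ac)
  moreover have "0 < card ?I" using f finI by (auto simp: card_gt_0_iff)
  ultimately show ?thesis by simp
qed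

text \<open>The greedy cover is applied to all pairs of a \<open>z\<close>-set and a placement.
  There are at most \<open>n ^ (2 * k)\<close> of them, and \<open>T\<close> choices leave less than
  one uncovered.\<close>

lemma ex_separating_family:
  fixes idx :: "'v \<Rightarrow> nat"
  assumes U: "finite U" "card U = n" and k: "2 \<le> k" "k \<le> n" "k dvd n"
    and J: "finite J" and idx: "bij_betw idx J {..<k}"
  shows "\<exists>F\<subseteq>{Vs. equipartition U k Vs}.
    real (card F) \<le> 2 * (4 * real k) ^ z * real k * log 2 (real n) \<and>
    (\<forall>Z f. Z \<subseteq> J \<longrightarrow> card Z = z \<longrightarrow> f \<in> J \<rightarrow> U \<longrightarrow> inj_on f J \<longrightarrow>
      (\<exists>Vs\<in>F. separates J f (part idx Vs) Z))"
proof -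
  let ?O = "{Vs. equipartition U k Vs}" and ?I = "{f \<in> J \<rightarrow>\<^sub>E U. inj_on f J}"
  obtain m where n: "n = k * m" using k(3) by (elim dvdE)
  have m: "0 < m" using n k by (cases m) auto
  have cardJ: "card J = k" using bij_betw_same_card[OF idx] by simp
  define R where "R = {Z. Z \<subseteq> J \<and> card Z = z} \<times> ?I"
  define good where "good Vs r = separates J (snd r) (part idx Vs) (fst r)" for Vs and r :: "'v set \<times> ('v \<Rightarrow> 'v)"
  define p where "p = 1 / (4 * real k) ^ z"
  define \<tau> where "\<tau> = 2 * (4 * real k) ^ z * real k * log 2 (real n)"
  \<comment> \<open>Rounding down costs less than one step, so \<open>p * T > p * \<tau> - 1\<close>
    because \<open>p \<le> 1\<close>.\<close>
  define T where "T = nat \<lfloor>\<tau>\<rfloor>"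
  have fin: "finite (J \<rightarrow>\<^sub>E U)" using J U by (auto intro: finite_PiE)
  have finR: "finite R"
    unfolding R_def using J fin by (auto intro!: finite_cartesian_product)
  have "card R \<le> card (Pow J \<times> (J \<rightarrow>\<^sub>E U))"
    unfolding R_def using J fin by (intro card_mono) auto
  also have "\<dots> = 2 ^ k * n ^ k"
    using J cardJ U by (simp add: card_cartesian_product card_Pow card_PiE)
  finally have cardR: "real (card R) \<le> (2 * real n) ^ k"
    by (simp add: power_mult_distrib flip: of_nat_le_iff[where 'a = real])
  have "1 \<le> (4 * real k) ^ z" using k by (intro one_le_power) simp
  then have p: "0 < p" "p \<le> 1" using k by (auto simp: p_def)
  have "\<exists>F\<subseteq>?O. card F \<le> T \<and> real (card {r \<in> R. \<forall>Vs\<in>F. \<not> good Vs r}) \<le> (1 - p) ^ T * real (card R)"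
  proof (rule ex_small_cover)
    show "finite ?O" using U by (intro finite_equipartitions)
    show "?O \<noteq> {}" using ex_equipartition[of U k m] U n k m by auto
    fix r assume "r \<in> R"
    then have "card ?O \<le> (4 * k) ^ z * card {Vs \<in> ?O. good Vs r}"
      unfolding good_def using U n k m J idx
      by (intro separating_partitions_fraction) (auto simp: R_def)
    then have "real (card ?O) \<le> real ((4 * k) ^ z * card {Vs \<in> ?O. good Vs r})"
      by (simp only: of_nat_le_iff)
    then show "p * real (card ?O) \<le> real (card {Vs \<in> ?O. good Vs r})"
      using k by (simp add: p_def field_simps)
  qed (use finR p in auto)
  then obtain F where F: "F \<subseteq> ?O" "card F \<le> T"
    and unc: "real (card {r \<in> R. \<forall>Vs\<in>F. \<not> good Vs r}) \<le> (1 - p) ^ T * real (card R)" by blast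
  have lg: "1 \<le> log 2 (real n)" using k by (simp add: le_log_iff)
  have \<tau>0: "0 \<le> \<tau>" using lg by (simp add: \<tau>_def)
  have "(1 - p) ^ T * real (card R) < 1"
  proof -
    have p\<tau>: "p * \<tau> = 2 * real k * log 2 (real n)"
      using k by (simp add: p_def \<tau>_def)
    have "\<tau> < real T + 1" using \<tau>0 unfolding T_def by linarith
    then have "p * \<tau> < p * real T + 1"
      using p mult_strict_left_mono[of \<tau> "real T + 1" p] by (simp add: distrib_left)
    \<comment> \<open>Replacing \<open>ln 2\<close> by 3/4 leaves a quarter of
      \<open>2 * k * log 2 n\<close>, a quantity of at least 4; this pays for the 1 lost by
      rounding.\<close>
    moreover have ln2: "ln 2 \<le> (3 / 4 :: real)"
    proof -
      have "2 \<le> exp (3 / 4 :: real)"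
        using exp_lower_Taylor_quadratic[of "3 / 4 :: real"] by (simp add: power2_eq_square)
      then show ?thesis by (subst ln_exp[symmetric]) (simp del: ln_exp)
    qed
    moreover have "2 * real k * log 2 (real n) * (3 / 4) + 1 \<le> 2 * real k * log 2 (real n)"
      using mult_mono[of 4 "2 * real k" 1 "log 2 (real n)"] k lg by simp
    moreover have "2 * real k * log 2 (real n) * ln 2 \<le> 2 * real k * log 2 (real n) * (3 / 4)"
      using ln2 lg by (intro mult_left_mono) auto
    ultimately have less: "2 * real k * log 2 (real n) * ln 2 < p * real T" using p\<tau> by linarith
    have ln: "log 2 (real n) * ln 2 = ln (real n)" by (simp add: log_def)
    \<comment> \<open>Uses \<open>2 \<le> n\<close>.\<close>
    have "real (card R) \<le> (real n * real n) ^ k"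
      using k by (intro order_trans[OF cardR] power_mono) (auto intro: mult_right_mono)
    also have "\<dots> = exp (2 * real k * ln (real n))"
    proof -
      have "exp (ln (real n) + ln (real n)) = real n * real n" using k by (subst exp_add) simp
      then have "(real n * real n) ^ k = exp (ln (real n) + ln (real n)) ^ k" by simp
      also have "\<dots> = exp (real k * (ln (real n) + ln (real n)))" by (simp only: exp_of_nat_mult)
      finally show ?thesis by (simp add: algebra_simps)
    qed
    also have "\<dots> < exp (p * real T)" using less ln by (simp add: mult.assoc)
    finally have R: "real (card R) < exp (p * real T)" .
    have "(1 - p) ^ T \<le> exp (- p) ^ T"
      using p exp_ge_add_one_self[of "- p"] by (intro power_mono) auto
    also have "\<dots> = exp (- (p * real T))" by (simp add: mult.commute flip: exp_of_nat_mult)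
    finally have "(1 - p) ^ T * real (card R) \<le> exp (- (p * real T)) * real (card R)"
      by (rule mult_right_mono) simp
    also have "\<dots> < exp (- (p * real T)) * exp (p * real T)" using R by simp
    finally show ?thesis by (simp flip: exp_add)
  qed
  \<comment> \<open>A natural number below 1.\<close>
  with unc have "card {r \<in> R. \<forall>Vs\<in>F. \<not> good Vs r} = 0" by simp
  moreover have "finite {r \<in> R. \<forall>Vs\<in>F. \<not> good Vs r}" using finR by simp
  ultimately have "{r \<in> R. \<forall>Vs\<in>F. \<not> good Vs r} = {}" using card_0_eq by blast
  then have all: "\<exists>Vs\<in>F. good Vs r" if "r \<in> R" for r
    using that by blast
  have "\<exists>Vs\<in>F. separates J f (part idx Vs) Z"
    if Zf: "Z \<subseteq> J" "card Z = z" "f \<in> J \<rightarrow> U" "inj_on f J" for Z f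
  proof -
    \<comment> \<open>\<open>R\<close> holds only extensional placements; separation depends on the
      values on \<open>J\<close> alone.\<close>
    have "(Z, restrict f J) \<in> R" using Zf by (auto simp: R_def inj_on_def)
    then show ?thesis using all[of "(Z, restrict f J)"] by (auto simp: good_def separates_def)
  qed
  moreover have "real (card F) \<le> \<tau>" using F(2) \<tau>0 unfolding T_def by linarith
  ultimately show ?thesis using F(1) unfolding \<tau>_def by blast
qed

section \<open>The size bound\<close>

text \<open>One block of parity states for each pebble set occurring in \<open>S\<close> gives a
  network independent of \<open>\<sigma>\<close>; each \<open>\<sigma>\<close> is then handled by
  its own instance of the locale.\<close>

lemma m_size_le_separating_family:
  fixes V V0 :: "'v set" and E E0 :: "('v \<times> 'v) set" and F :: "('v \<Rightarrow> 'v set) set"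
  assumes E: "input_graph V E" and st: "s \<in> V" "t \<in> V" "s \<noteq> t"
    and sub: "V0 \<subseteq> V" "E0 \<subseteq> E"
    and lolli: "\<forall>v \<in> V - V0. lollipop V s t E v"
    and J: "J = V0 - {s, t}" and n: "n = card (V - {s, t})"
    and F: "finite F" "\<And>x i. x \<in> F \<Longrightarrow> i \<in> J \<Longrightarrow> x i \<subseteq> V - {s, t}"
    and sep: "\<And>Q \<sigma>. Q \<subseteq> J \<Longrightarrow> card Q \<le> z \<Longrightarrow> \<sigma> permutes (V - {s, t}) \<Longrightarrow>
      \<exists>x\<in>F. separates J \<sigma> x Q"
    and S: "S \<subseteq> {P. P \<subseteq> V0 \<and> card (P - {s, t}) \<le> z}" "pebble_winnable s t E0 S"
  shows "m_size V s t E \<le>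
    enat (card S * ((card F * card F * Suc n + card F * (Suc n)\<^sup>2 * Suc z) * 2 ^ z))"
proof -
  have finV: "finite V" and EV: "E \<subseteq> V \<times> V" and irr: "irrefl E"
    using E by (auto simp: input_graph_def)
  obtain us where us: "set us = V - {s, t}" "distinct us"
    using finite_distinct_list[of "V - {s, t}"] finV by auto
  have len: "length us = n" using distinct_card[OF us(2)] us(1) n by simp
  \<comment> \<open>States differing only at \<open>s\<close> or \<open>t\<close> share a block, so
    there are at most \<open>card S\<close> blocks.\<close>
  define QS where "QS = (\<lambda>P. P - {s, t}) ` S"
  define T where "T = (\<Union>Q\<in>QS. parity_states V s t us F Q)"
  have finV0: "finite V0" using sub finV finite_subset by blast
  have "S \<subseteq> Pow V0" using S by auto
  then have finS: "finite S" using finV0 by (meson finite_Pow_iff finite_subset)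
  have QS_le: "Q \<subseteq> J" "card Q \<le> z" "finite Q" if "Q \<in> QS" for Q
    using that S J finV0 by (auto simp: QS_def intro: finite_subset)
  note par = card_parity_states[OF F(1) QS_le(3,2)]
  let ?c = "(card F * card F * Suc n + card F * (Suc n)\<^sup>2 * Suc z) * 2 ^ z"
  have finT: "finite T" unfolding T_def using finS par(1) by (auto simp: QS_def)
  have "card T \<le> (\<Sum>Q\<in>QS. card (parity_states V s t us F Q))"
    unfolding T_def using finS by (intro card_UN_le) (simp add: QS_def)
  also have "\<dots> \<le> (\<Sum>Q\<in>QS. ?c)" using par(2)[where us = us] unfolding len by (intro sum_mono) blast
  also have "\<dots> \<le> card S * ?c"
    unfolding QS_def sum_constant of_nat_id by (intro mult_le_mono1 card_image_le finS)
  finally have card_T: "card T \<le> card S * ?c" .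
  have "m_size V s t E \<le> enat (card T)"
  proof (rule m_size_le_card[OF E st(1,2) finT refl])
    fix \<sigma> assume \<sigma>: "\<sigma> permutes (V - {s, t})"
    interpret lollipop_network V s t "image_graph \<sigma> E" us J \<sigma> F QS
    proof
      show "\<sigma> ` J \<subseteq> V - {s, t}"
        using permutes_image[OF \<sigma>] sub(1) J by blast
      fix u assume u: "u \<in> V - {s, t}" "u \<notin> \<sigma> ` J"
      then obtain v where v: "v \<in> V - {s, t}" "u = \<sigma> v"
        using permutes_image[OF \<sigma>] by blast
      then have "v \<in> V - V0" using u J by auto
      then have "(s, v) \<in> E \<or> (v, t) \<in> E" using lolli by (auto simp: lollipop_def)
      moreover have "\<sigma> s = s" "\<sigma> t = t" using \<sigma> by (auto simp: permutes_def)
      ultimately show "(s, u) \<in> image_graph \<sigma> E \<or> (u, t) \<in> image_graph \<sigma> E"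
        unfolding image_graph_def v(2) by force
    qed (use finV st us F QS_le in auto)
    have "connected (cuts V s t) {}"
    proof (rule connected_game)
      show "\<sigma> s = s" "\<sigma> t = t" using \<sigma> by (auto simp: permutes_def)
      show "(\<sigma> v, \<sigma> w) \<in> image_graph \<sigma> E" if "(v, w) \<in> E0" for v w
        using that sub(2) by (auto simp: image_graph_def)
      show "\<exists>x\<in>F. separates J \<sigma> x Q" if "Q \<in> QS" for Q
        using sep[OF QS_le(1,2)[OF that] \<sigma>] .
      show "P - {s, t} \<in> QS" if "P \<in> S" for P using that by (simp add: QS_def)
      show "pebble_winnable s t E0 S" by (rule S)
      show "irrefl E0" using irr sub(2) by (auto simp: irrefl_def)
    qed
    then show "(cuts V s t, {}) \<in> (cut_link V s t (image_graph \<sigma> E) \<inter>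
        insert (cuts V s t) (insert {} T) \<times> insert (cuts V s t) (insert {} T))\<^sup>*"
      by (simp add: Ver_def T_def)
  qed
  also have "\<dots> \<le> enat (card S * ?c)" using card_T by simp
  finally show ?thesis .
qed

text \<open>With a factor \<open>f\<close> taken out, the shifts \<open>n = n' + 2\<close> and
  \<open>z = z' + 1\<close> make the inequality hold coefficient by coefficient.\<close>

lemma network_size_arith:
  fixes n z f :: nat
  assumes "2 \<le> n" "1 \<le> z"
  shows "f * f * Suc n + f * (Suc n)\<^sup>2 * Suc z \<le> 2 * z * (f * n * (2 * f + 4 + z * n))"
proof -
  obtain n' z' where n: "n = n' + 2" and z: "z = z' + 1"
    using assms by (metis add.commute le_Suc_ex)
  have "f * Suc n + (Suc n)\<^sup>2 * Suc z \<le> 2 * z * (n * (2 * f + 4 + z * n))"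
    unfolding n z by (simp add: power2_eq_square algebra_simps)
  then have "f * (f * Suc n + (Suc n)\<^sup>2 * Suc z) \<le> f * (2 * z * (n * (2 * f + 4 + z * n)))"
    by (rule mult_le_mono2)
  then show ?thesis by (simp add: algebra_simps)
qed

theorem theorem3p10:
  fixes V V0 :: "'v set" and s t :: 'v and E E0 :: "('v \<times> 'v) set" and k n z :: nat
  assumes "input_graph V E"
    and "s \<in> V" and "t \<in> V" and "s \<noteq> t"
    and "V0 \<subseteq> V" and "E0 \<subseteq> E" and "E0 \<subseteq> V0 \<times> V0" and "s \<in> V0" and "t \<in> V0"
    and "(s, t) \<in> E0\<^sup>*"
    and "\<forall>v \<in> V - V0. lollipop V s t E v"
    and "k = card (V0 - {s, t})" and "k \<ge> 2"
    and "n = card (V - {s, t})" and "k dvd n"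
    and "1 \<le> z" and "z \<le> k"
  shows "\<exists>F :: 'v set list set. finite F \<and>
           (\<forall>Vs\<in>F. equipartition (V - {s, t}) k Vs) \<and>
           real (card F) \<le> 2 * (4 * real k) ^ z * real k * log 2 (real n) \<and>
           ereal_of_enat (m_size V s t E) \<le>
             ereal (2 * real z * 2 ^ z) * ereal_of_enat (r_size V0 s t {E0} z) *
             ereal (real (card F) * real n * log 2 (real n) *
                    (2 * real (card F) + 4 + real z * real n))"
proof -
  have finV: "finite V" using assms(1) by (simp add: input_graph_def)
  define J where "J = V0 - {s, t}"
  have J: "finite J" "J \<subseteq> V - {s, t}" "card J = k"
    using finV assms by (auto simp: J_def intro: finite_subset)
  have kn: "k \<le> n" using J finV assms(14) card_mono[of "V - {s, t}" J] by simp
  then have n: "2 \<le> n" using assms(13) by simp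
  obtain idx where idx: "bij_betw idx J {..<k}"
    using ex_bij_betw_finite_nat[OF J(1)] J(3) by (auto simp: atLeast0LessThan)
  have finU: "finite (V - {s, t})" using finV by simp
  obtain F where F: "F \<subseteq> {Vs. equipartition (V - {s, t}) k Vs}"
    and cardF: "real (card F) \<le> 2 * (4 * real k) ^ z * real k * log 2 (real n)"
    and sep: "\<And>Z f. Z \<subseteq> J \<Longrightarrow> card Z = z \<Longrightarrow> f \<in> J \<rightarrow> V - {s, t} \<Longrightarrow> inj_on f J \<Longrightarrow>
      \<exists>Vs\<in>F. separates J f (part idx Vs) Z"
    using ex_separating_family[OF finU assms(14)[symmetric] assms(13) kn assms(15) J(1) idx, of z]
    by blast
  have finF: "finite F" using finite_subset[OF F finite_equipartitions[OF finU]] .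
  have sep': "\<exists>Vs\<in>F. separates J \<sigma> (part idx Vs) Q"
    if Q: "Q \<subseteq> J" "card Q \<le> z" and \<sigma>: "\<sigma> permutes (V - {s, t})" for Q \<sigma>
  proof -
    \<comment> \<open>The family serves sets of exactly \<open>z\<close> vertices; a smaller pebble
      set is first enlarged, which \<open>z \<le> k\<close> permits.\<close>
    obtain Z where Z: "Q \<subseteq> Z" "Z \<subseteq> J" "card Z = z"
      using exists_subset_between[OF Q(2) _ Q(1) J(1)] J(3) assms(17) by auto
    have "\<sigma> \<in> J \<rightarrow> V - {s, t}" using J(2) permutes_image[OF \<sigma>] by blast
    moreover have "inj_on \<sigma> J" using permutes_inj_on[OF \<sigma>] .
    ultimately show ?thesis using sep[OF Z(2,3)] separates_mono[OF _ Z(1)] by blast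
  qed
  \<comment> \<open>Even the empty pebble set has a separating member, so the last factor of the
    bound is positive.\<close>
  have Fne: "0 < card F"
    using sep'[of "{}" id] permutes_id finF by (auto simp: card_gt_0_iff)
  have lg: "1 \<le> log 2 (real n)" using n by (simp add: le_log_iff)
  let ?b = "real (card F) * real n * log 2 (real n) * (2 * real (card F) + 4 + real z * real n)"
  have b: "0 < ?b" using Fne n lg by (intro mult_pos_pos add_pos_nonneg) auto
  have a: "0 < 2 * real z * 2 ^ z" using assms(16) by simp
  have "ereal_of_enat (m_size V s t E) \<le>
      ereal (2 * real z * 2 ^ z) * ereal_of_enat (r_size V0 s t {E0} z) * ereal ?b"
  proof (cases "r_size V0 s t {E0} z")
    \<comment> \<open>All other factors are positive, so the right-hand side is infinite.\<close>
    case infinity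
    have "ereal (2 * real z * 2 ^ z) * \<infinity> = \<infinity>"
      by (rule ereal_mult_eq_PInfty[THEN iffD2]) (use a in auto)
    moreover have "\<infinity> * ereal ?b = \<infinity>"
      by (rule ereal_mult_eq_PInfty[THEN iffD2]) (use b in auto)
    ultimately show ?thesis unfolding infinity ereal_of_enat_simps by simp
  next
    case (enat r)
    let ?A = "{enat (card S) | S. S \<subseteq> {P. P \<subseteq> V0 \<and> card (P - {s, t}) \<le> z} \<and>
      (\<forall>E\<in>{E0}. pebble_winnable s t E S)}"
    \<comment> \<open>A finite infimum of extended naturals is attained, which yields an optimal
      \<open>S\<close>.\<close>
    have "?A \<noteq> {}" using enat unfolding r_size_def by (metis Inf_enat_def enat.distinct(1))
    then have "Inf ?A \<in> ?A" unfolding Inf_enat_def using LeastI_ex[of "\<lambda>x. x \<in> ?A"] by auto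
    then have "enat r \<in> ?A" using enat unfolding r_size_def by simp
    then obtain S where S: "S \<subseteq> {P. P \<subseteq> V0 \<and> card (P - {s, t}) \<le> z}"
      "pebble_winnable s t E0 S" and r: "card S = r" by auto
    let ?f = "card (part idx ` F)"
    let ?m = "r * ((?f * ?f * Suc n + ?f * (Suc n)\<^sup>2 * Suc z) * 2 ^ z)"
    let ?m' = "r * ((2 * z * (card F * n * (2 * card F + 4 + z * n))) * 2 ^ z)"
    have "m_size V s t E \<le> enat ?m"
      unfolding r[symmetric]
    proof (rule m_size_le_separating_family[OF assms(1-6) assms(11) J_def assms(14) _ _ _ S])
      show "finite (part idx ` F)" using finF by simp
      show "\<exists>x\<in>part idx ` F. separates J \<sigma> x Q"
        if "Q \<subseteq> J" "card Q \<le> z" "\<sigma> permutes (V - {s, t})" for Q \<sigma>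
        using sep'[OF that] by blast
      fix x i assume "x \<in> part idx ` F" "i \<in> J"
      then obtain Vs where x: "x = part idx Vs" "equipartition (V - {s, t}) k Vs" using F by auto
      then have "x i \<in> set Vs"
        using bij_betwE[OF idx] \<open>i \<in> J\<close> by (simp add: part_def equipartition_def)
      then show "x i \<subseteq> V - {s, t}" using x by (auto simp: equipartition_def partition_on_def)
    qed
    moreover have "?m \<le> ?m'"
    proof -
      have f: "?f \<le> card F" using finF by (rule card_image_le)
      have "?f * ?f * Suc n + ?f * (Suc n)\<^sup>2 * Suc z \<le>
          card F * card F * Suc n + card F * (Suc n)\<^sup>2 * Suc z"
        by (intro add_mono mult_le_mono f order.refl)
      also have "\<dots> \<le> 2 * z * (card F * n * (2 * card F + 4 + z * n))"
        by (rule network_size_arith[OF n assms(16)])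
      finally show ?thesis by (intro mult_le_mono order.refl)
    qed
    ultimately have "m_size V s t E \<le> enat ?m'" by (meson enat_ord_simps(1) order_trans)
    then have "ereal_of_enat (m_size V s t E) \<le> ereal_of_enat (enat ?m')"
      by (simp only: ereal_of_enat_le_iff)
    \<comment> \<open>The network bound has no logarithm; the factor 1 marks where
      \<open>log 2 n \<ge> 1\<close> is put in next.\<close>
    also have "\<dots> = ereal (2 * real z * 2 ^ z * real r *
        (real (card F) * real n * 1 * (2 * real (card F) + 4 + real z * real n)))"
      by (simp add: mult_ac)
    also have "\<dots> \<le> ereal (2 * real z * 2 ^ z * real r * ?b)"
      using lg unfolding ereal_less_eq(3) by (intro mult_left_mono mult_right_mono) auto
    finally show ?thesis using enat by simp
  qed
  then show ?thesis using F finF cardF by (intro exI[of _ F]) auto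
qed

end
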